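(* Let $n\geqslant1$ be an integer, let $\varphi\in U_{2n}^*$ and suppose that $\varphi$ has exactly $2m$ nonreal zeroes, counting multiplicities. Let $Q=\left(\varphi'/\varphi\right)'$. Then $$Z_\mathbb{R}(Q)\geqslant 2m-2m_{1}+2n-2,$$ where $2m_1$ is the number of nonreal zeroes of $\varphi'$, counting multiplicities.
   Context: For an integer $n\geqslant0$, $V_{2n}$ is the class of functions $$f(z)=cz^de^{-\gamma z^{2n+2}+q(z)}\prod_{j=1}^{\omega}\left(1-\frac{z}{\alpha_j}\right)e^{\frac{z}{\alpha_j}+\frac{z^2}{2\alpha_j^2}+\ldots+\frac{z^{l}}{l\alpha_j^{l}}},\quad 0\leqslant\omega\leqslant\infty,$$ where $\gamma\geqslant0$, $q$ is a real polynomial with $\deg q\leqslant2n+1$, $l\leqslant2n+1$ is a nonnegative integer (no exponential factors if $l=0$), $\alpha_j\in\mathbb{R}\setminus\{0\}$, $\sum_j|\alpha_j|^{-l-1}<\infty$, $d$ is a nonnegative integer, $c\in\mathbb{R}$, $c\neq0$. Put $U_0=V_0$ and $U_{2n}=V_{2n}\setminus V_{2n-2}$ for $n\geqslant1$. A function $\varphi$ is in $U_{2n}^*$ if $\varphi=pf$ where $f\in U_{2n}$ and $p$ is a real polynomial with no real zeroes (nonzero constants allowed). $Z_{\mathbb{R}}(Q)$ denotes the number of real zeroes of the meromorphic function $Q$, counting multiplicities (with value $\infty$ if there are infinitely many). *)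

theory Defs
  imports "HOL-Complex_Analysis.Complex_Analysis"
begin

text \<open>
  \<open>V_class n\<close>, \<open>U_class n\<close> and \<open>U_star n\<close> stand for $V_{2n}$, $U_{2n}$ and $U_{2n}^*$: the argument
  is half of the subscript. The numbers \<open>\<alpha> j\<close> that matter are those with \<open>1 \<le> j \<le> \<omega>\<close>; the other
  factors of the infinite product are 1. The Weierstrass factor of the library is
  $(1-u)\exp(u+u^2/2+\dots+u^l/l)$.
\<close>

definition V_class :: "nat \<Rightarrow> (complex \<Rightarrow> complex) set" where
  "V_class n = {f. \<exists>(c::real) (d::nat) (\<gamma>::real) (q::real poly) (\<omega>::enat) (l::nat) (\<alpha>::nat \<Rightarrow> real).
     c \<noteq> 0 \<and> \<gamma> \<ge> 0 \<and> degree q \<le> 2 * n + 1 \<and> l \<le> 2 * n + 1 \<and>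
     (\<forall>j. 1 \<le> j \<and> enat j \<le> \<omega> \<longrightarrow> \<alpha> j \<noteq> 0) \<and>
     summable (\<lambda>j. if 1 \<le> j \<and> enat j \<le> \<omega> then 1 / \<bar>\<alpha> j\<bar> ^ (l + 1) else 0) \<and>
     (\<forall>z. f z = of_real c * z ^ d
        * exp (- of_real \<gamma> * z ^ (2 * n + 2) + poly (map_poly of_real q) z)
        * (\<Prod>j. if 1 \<le> j \<and> enat j \<le> \<omega> then weierstrass_factor l (z / of_real (\<alpha> j)) else 1))}"

definition U_class :: "nat \<Rightarrow> (complex \<Rightarrow> complex) set" where
  "U_class n = (if n = 0 then V_class 0 else V_class n - V_class (n - 1))"

definition U_star :: "nat \<Rightarrow> (complex \<Rightarrow> complex) set" where
  "U_star n = {\<phi>. \<exists>f\<in>U_class n. \<exists>p::real poly. (\<forall>x. poly p x \<noteq> 0) \<and>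
     (\<forall>z. \<phi> z = poly (map_poly of_real p) z * f z)}"

text \<open>
  Multiplicity of \<open>z\<close> as a zero of a meromorphic function (0 if \<open>z\<close> is not a zero). It depends only
  on a punctured neighbourhood of \<open>z\<close>, so the junk value that a total function has at a pole is not
  mistaken for a zero. Where the function vanishes identically \<^const>\<open>zorder\<close> is unspecified,
  hence the case distinction.
\<close>

definition zero_mult :: "(complex \<Rightarrow> complex) \<Rightarrow> complex \<Rightarrow> enat" where
  "zero_mult f z = (if \<forall>\<^sub>F w in at z. f w = 0 then \<infinity> else enat (nat (zorder f z)))"

definition zero_count :: "(complex \<Rightarrow> complex) \<Rightarrow> complex set \<Rightarrow> enat" where
  "zero_count f A =
     (if finite {z \<in> A. zero_mult f z \<noteq> 0}
      then \<Sum>z \<in> {z \<in> A. zero_mult f z \<noteq> 0}. zero_mult f z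
      else \<infinity>)"

abbreviation real_zeros :: "(complex \<Rightarrow> complex) \<Rightarrow> enat" where
  "real_zeros f \<equiv> zero_count f \<real>"

abbreviation nonreal_zeros :: "(complex \<Rightarrow> complex) \<Rightarrow> enat" where
  "nonreal_zeros f \<equiv> zero_count f (- \<real>)"

end

theory Submission
  imports Defs "HOL-Real_Asymp.Real_Asymp"
begin

text \<open>
  Write \<open>\<phi> = p f\<close> with \<open>f\<close> in \<open>U_class n\<close> and \<open>p\<close> a real polynomial without real zeros; the
  degree of \<open>p\<close> is at least \<open>2 m\<close> (\<open>nonreal_zeros_le_degree\<close>). The proof compares two
  estimates for the growth of \<open>N = \<phi>' / f\<close> on the positive imaginary axis. It may be assumed
  that \<open>Q\<close> has finitely many real zeros.

  The divisor of \<open>N\<close> consists of simple poles at the real zeros of \<open>\<phi>\<close>, of the nonreal zeros of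
  \<open>\<phi>'\<close>, and of the real zeros of \<open>\<phi>'\<close> that are not zeros of \<open>\<phi>\<close>. From each interval between
  zeros of \<open>\<phi>\<close> set aside the first zero of \<open>\<phi>'\<close> in it, if there is one. These
  zeros alternate with the poles, and
  by Rolle's theorem every further real zero of \<open>N\<close> accounts for a zero of \<open>Q\<close>. So the number
  \<open>D\<close> of zeros of \<open>N\<close> that are not set aside is at most \<open>2 m\<^sub>1\<close> plus the number of real zeros of
  \<open>Q\<close> (\<open>divisor_of_deriv_quotient\<close>).

  A product of linear factors with alternating real zeros and poles maps the upper half-plane into
  itself, up to sign, and therefore grows at most linearly on the imaginary axis. What remains of
  \<open>N\<close> after division by such a product is, up to a constant, a polynomial of degree \<open>D\<close>; this is
  the factorisation of Levin and Ostrovskii. Hence \<open>N (\<i> y)\<close> is at most of order \<open>y ^ (D + 1)\<close>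
  (\<open>growth_from_alternating_divisor\<close>).

  Conversely \<open>N = p' + p f' / f\<close>, and \<open>f' / f\<close> is not of smaller order than \<open>y ^ (2 n - 1)\<close>,
  for otherwise \<open>f\<close> would belong to \<open>V_class (n - 1)\<close> (\<open>V_form_drop\<close>). Comparing exponents gives
  \<open>D + 1 \<ge> 2 m + 2 n - 1\<close>, which is the claim.
\<close>

section \<open>Functions with values in a half-plane\<close>

text \<open>
  The Cayley transform of a function with positive real part maps the disc into itself, so the
  Schwarz lemma applies. A positive \<open>\<epsilon>\<close> is added first, because \<open>F\<close> may be an imaginary
  constant, whose Cayley transform has a vanishing denominator.
\<close>

lemma caratheodory_unit_disc:
  fixes F :: "complex \<Rightarrow> complex"
  assumes holo: "F holomorphic_on ball 0 1"
    and Re: "\<And>z. norm z < 1 \<Longrightarrow> 0 \<le> Re (F z)"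
    and z: "norm z < 1"
  shows "norm (F z - F 0) \<le> 2 * Re (F 0) * norm z / (1 - norm z)"
proof -
  have pos: "norm (F z - F 0) \<le> 2 * (Re (F 0) + \<epsilon>) * norm z / (1 - norm z)" if "\<epsilon> > 0" for \<epsilon>
  proof -
    define G where "G = (\<lambda>z. F z + of_real \<epsilon>)"
    define h where "h = (\<lambda>z. (G z - G 0) / (G z + cnj (G 0)))"
    have ReG: "Re (G z) > 0" if "norm z < 1" for z
      using Re[OF that] \<open>\<epsilon> > 0\<close> by (simp add: G_def)
    have nz: "G z + cnj (G 0) \<noteq> 0" if "norm z < 1" for z
    proof
      assume "G z + cnj (G 0) = 0"
      then have "Re (G z) + Re (G 0) = 0"
        by (metis cnj.sel(1) plus_complex.sel(1) zero_complex.sel(1))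
      with ReG[OF that] ReG[of 0] show False by simp
    qed
    have less: "norm (h z) < 1" if "norm z < 1" for z
    proof -
      have "(norm (G z - G 0))\<^sup>2 < (norm (G z + cnj (G 0)))\<^sup>2"
        using mult_pos_pos[OF ReG[OF that] ReG[of 0]]
        by (simp only: cmod_power2) (simp add: power2_eq_square algebra_simps)
      then have "norm (G z - G 0) < norm (G z + cnj (G 0))"
        by (rule power_less_imp_less_base) simp
      then show ?thesis
        using nz[OF that] by (simp add: h_def norm_divide)
    qed
    have "norm (h z) \<le> norm z"
    proof (rule Schwarz_Lemma(1))
      show "h holomorphic_on ball 0 1"
        unfolding h_def G_def using nz holo by (auto intro!: holomorphic_intros simp: G_def)
    qed (use less z in \<open>auto simp: h_def\<close>)
    have "G z - G 0 = h z * ((G z - G 0) + 2 * of_real (Re (G 0)))"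
    proof -
      have "G z - G 0 = h z * (G z + cnj (G 0))"
        using nz[OF z] by (simp add: h_def)
      also have "G z + cnj (G 0) = (G z - G 0) + (G 0 + cnj (G 0))"
        by simp
      finally show ?thesis by (simp add: complex_add_cnj)
    qed
    then have "norm (G z - G 0) \<le> norm (h z) * (norm (G z - G 0) + 2 * Re (G 0))"
      using norm_triangle_ineq[of "G z - G 0" "2 * of_real (Re (G 0))"] ReG[of 0]
      by (metis (no_types, lifting) abs_of_pos mult_left_mono norm_ge_zero norm_mult norm_numeral
          norm_of_real zero_less_one norm_zero)
    also have "\<dots> \<le> norm z * (norm (G z - G 0) + 2 * Re (G 0))"
      using \<open>norm (h z) \<le> norm z\<close> ReG[of 0] by (intro mult_right_mono) auto
    finally have "norm (G z - G 0) * (1 - norm z) \<le> 2 * Re (G 0) * norm z"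
      by (simp add: algebra_simps)
    then show ?thesis
      using z by (simp add: G_def field_simps)
  qed
  have "((\<lambda>\<epsilon>. 2 * (Re (F 0) + \<epsilon>) * norm z / (1 - norm z)) \<longlongrightarrow>
        2 * (Re (F 0) + 0) * norm z / (1 - norm z)) (at_right 0)"
    using z by (intro tendsto_intros) auto
  moreover have "\<forall>\<^sub>F \<epsilon> in at_right 0.
      norm (F z - F 0) \<le> 2 * (Re (F 0) + \<epsilon>) * norm z / (1 - norm z)"
    using pos eventually_at_right_less[of "0::real"] by (auto elim: eventually_mono)
  ultimately have "norm (F z - F 0) \<le> 2 * (Re (F 0) + 0) * norm z / (1 - norm z)"
    by (intro tendsto_lowerbound) auto
  then show ?thesis by simp
qed

lemma caratheodory_disc:
  fixes F :: "complex \<Rightarrow> complex"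
  assumes holo: "F holomorphic_on ball c R"
    and Re: "\<And>z. z \<in> ball c R \<Longrightarrow> 0 \<le> Re (F z)"
    and z: "z \<in> ball c R"
  shows "norm (F z - F c) \<le> 2 * Re (F c) * norm (z - c) / (R - norm (z - c))"
proof -
  have R: "R > 0" using z by (metis dist_not_less_zero mem_ball not_less_iff_gr_or_eq order_le_less_trans zero_le_dist)
  have mem: "c + of_real R * w \<in> ball c R" if "norm w < 1" for w
    using that R by (simp add: dist_norm norm_mult)
  define w where "w = (z - c) / of_real R"
  have w: "norm w = norm (z - c) / R"
    using R by (simp add: w_def norm_divide)
  have "norm w < 1"
    using z R by (simp add: w dist_norm norm_minus_commute)
  have "norm (F (c + of_real R * w) - F (c + of_real R * 0))
        \<le> 2 * Re (F (c + of_real R * 0)) * norm w / (1 - norm w)"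
  proof (rule caratheodory_unit_disc)
    have "(F \<circ> (\<lambda>w. c + of_real R * w)) holomorphic_on ball 0 1"
      by (rule holomorphic_on_compose_gen[OF _ holo]) (use mem in \<open>auto intro!: holomorphic_intros\<close>)
    then show "(\<lambda>w. F (c + of_real R * w)) holomorphic_on ball 0 1"
      by (simp add: o_def)
  qed (use Re mem \<open>norm w < 1\<close> in auto)
  moreover have "c + of_real R * w = z" using R by (simp add: w_def)
  moreover have "2 * Re (F c) * norm w / (1 - norm w) = 2 * Re (F c) * norm (z - c) / (R - norm (z - c))"
    using R \<open>norm w < 1\<close> by (simp add: w field_simps)
  ultimately show ?thesis by simp
qed

text \<open>
  Caratheodory's inequality for \<open>- \<i> F\<close>, transported to the upper half-plane by the Moebius
  map that takes \<open>\<i> s\<close> to the centre of the disc. The two lemmas after it evaluate the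
  resulting bound, exactly on the imaginary axis and crudely elsewhere; the exact linear rate on the
  axis is what decides the constant in the final count.
\<close>

lemma half_plane_growth:
  fixes F :: "complex \<Rightarrow> complex" and s :: real
  assumes holo: "F holomorphic_on {z. Im z > 0}"
    and Im: "\<And>z. Im z > 0 \<Longrightarrow> 0 \<le> Im (F z)"
    and s: "s > 0" and z: "Im z > 0"
  shows "norm (F z) * (norm (z + \<i> * s) - norm (z - \<i> * s))
       \<le> norm (F (\<i> * s)) * (norm (z + \<i> * s) + norm (z - \<i> * s))"
proof -
  define T :: "complex \<Rightarrow> complex" where "T = (\<lambda>w. \<i> * s * (1 + w) / (1 - w))"
  have ImT: "Im (T w) > 0" if w: "norm w < 1" for w
  proof -
    have "Im (T w) = s * Re ((1 + w) / (1 - w))"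
      by (simp add: T_def mult.assoc flip: times_divide_eq_right)
    also have "Re ((1 + w) / (1 - w)) = Re ((1 + w) * cnj (1 - w)) / (norm (1 - w))\<^sup>2"
      by (simp only: complex_div_cnj[of "1 + w"] Re_divide_of_real flip: of_real_power)
    also have "Re ((1 + w) * cnj (1 - w)) = 1 - (norm w)\<^sup>2"
      by (simp only: cmod_power2) (simp add: power2_eq_square algebra_simps)
    finally have *: "Im (T w) = s * ((1 - (norm w)\<^sup>2) / (norm (1 - w))\<^sup>2)" .
    have "w \<noteq> 1" using w by auto
    moreover have "(norm w)\<^sup>2 < 1" using w by (simp add: power_less_one_iff abs_square_less_1)
    ultimately show ?thesis using s by (simp add: *)
  qed
  define w where "w = (z - \<i> * s) / (z + \<i> * s)"
  have ne: "z + \<i> * s \<noteq> 0"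
  proof
    assume "z + \<i> * s = 0"
    then have "Im (z + \<i> * s) = 0" by simp
    with s z show False by simp
  qed
  have "(norm (z - \<i> * s))\<^sup>2 < (norm (z + \<i> * s))\<^sup>2"
    using mult_pos_pos[OF s z] by (simp only: cmod_power2) (simp add: power2_eq_square algebra_simps)
  then have lt: "norm (z - \<i> * s) < norm (z + \<i> * s)"
    by (rule power_less_imp_less_base) simp
  then have w1: "norm w < 1"
    using ne by (simp add: w_def norm_divide)
  have Tw: "T w = z"
  proof -
    have "1 + w = 2 * z / (z + \<i> * s)" "1 - w = 2 * (\<i> * s) / (z + \<i> * s)"
      using ne by (simp_all add: w_def divide_simps)
    then show ?thesis
      using s ne by (simp add: T_def)
  qed
  have T0: "T 0 = \<i> * s" by (simp add: T_def)
  let ?G = "\<lambda>w. - \<i> * F (T w)"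
  have "norm (?G w - ?G 0) \<le> 2 * Re (?G 0) * norm w / (1 - norm w)"
  proof (rule caratheodory_unit_disc)
    have "(F \<circ> T) holomorphic_on ball 0 1"
      by (rule holomorphic_on_compose_gen[OF _ holo])
         (use ImT in \<open>auto intro!: holomorphic_intros simp: T_def\<close>)
    then show "?G holomorphic_on ball 0 1"
      by (auto intro!: holomorphic_intros simp: o_def)
  qed (use ImT Im w1 in auto)
  moreover have "norm (?G w - ?G 0) = norm (F z - F (\<i> * s))"
    using Tw T0 by (metis mult_minus_left norm_ii norm_minus_cancel norm_mult mult_1 right_diff_distrib)
  moreover have "Re (?G 0) \<le> norm (F (\<i> * s))"
    using abs_Im_le_cmod[of "F (\<i> * s)"] T0 by simp
  ultimately have "norm (F z - F (\<i> * s)) \<le> 2 * norm (F (\<i> * s)) * norm w / (1 - norm w)"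
    using w1 by (smt (verit) divide_right_mono mult_right_mono norm_ge_zero)
  then have "norm (F z) \<le> norm (F (\<i> * s)) + 2 * norm (F (\<i> * s)) * norm w / (1 - norm w)"
    using norm_triangle_sub[of "F z" "F (\<i> * s)"] by simp
  also have "\<dots> = norm (F (\<i> * s)) * (1 + norm w) / (1 - norm w)"
    using w1 by (simp add: field_simps)
  also have "norm w = norm (z - \<i> * s) / norm (z + \<i> * s)"
    by (simp add: w_def norm_divide)
  finally have "norm (F z) \<le> norm (F (\<i> * s)) * (1 + norm (z - \<i> * s) / norm (z + \<i> * s))
      / (1 - norm (z - \<i> * s) / norm (z + \<i> * s))" .
  moreover have "c * (1 + b / a) / (1 - b / a) = c * (a + b) / (a - b)" if "b < a" "0 < a" for a b c :: real
    using that by (simp add: divide_simps)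
  moreover have "norm (z + \<i> * s) > 0" using ne by simp
  ultimately have "norm (F z) \<le> norm (F (\<i> * s)) * (norm (z + \<i> * s) + norm (z - \<i> * s))
      / (norm (z + \<i> * s) - norm (z - \<i> * s))"
    using lt by metis
  then show ?thesis using lt
    by (simp only: pos_le_divide_eq diff_gt_0_iff_gt)
qed

lemma half_plane_growth_axis:
  fixes F :: "complex \<Rightarrow> complex" and s y :: real
  assumes "F holomorphic_on {z. Im z > 0}" "\<And>z. Im z > 0 \<Longrightarrow> 0 \<le> Im (F z)"
    and s: "0 < s" "s \<le> y"
  shows "norm (F (\<i> * of_real y)) \<le> y / s * norm (F (\<i> * of_real s))"
proof -
  have "norm (\<i> * of_real y + \<i> * of_real s) = y + s"
    using s by (simp flip: distrib_left of_real_add add: norm_mult)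
  moreover have "norm (\<i> * of_real y - \<i> * of_real s) = y - s"
    using s by (simp flip: right_diff_distrib of_real_diff add: norm_mult)
  ultimately have "norm (F (\<i> * of_real y)) * (y + s - (y - s)) \<le> norm (F (\<i> * of_real s)) * (y + s + (y - s))"
    using half_plane_growth[OF assms(1,2) s(1), of "\<i> * of_real y"] s by simp
  then show ?thesis
    using s by (simp add: field_simps)
qed

lemma half_plane_growth_poly:
  fixes F :: "complex \<Rightarrow> complex" and s y :: real
  assumes "F holomorphic_on {z. Im z > 0}" "\<And>z. Im z > 0 \<Longrightarrow> 0 \<le> Im (F z)"
    and s: "s > 0" and z: "Im z > 0"
  shows "norm (F z) \<le> (norm z + s)\<^sup>2 / (s * Im z) * norm (F (\<i> * of_real s))"
proof -
  define a b where "a = norm (z + \<i> * s)" and "b = norm (z - \<i> * s)"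
  have ab: "a * a - b * b = 4 * s * Im z"
  proof -
    have "a\<^sup>2 - b\<^sup>2 = 4 * s * Im z"
      unfolding a_def b_def by (simp only: cmod_power2) (simp add: power2_eq_square algebra_simps)
    then show ?thesis by (simp add: power2_eq_square)
  qed
  have le: "a + b \<le> 2 * (norm z + s)" 
    using norm_triangle_ineq[of z "\<i> * s"] norm_triangle_ineq4[of z "\<i> * s"] s
    by (simp add: a_def b_def norm_mult)
  have nn: "a \<ge> 0" "b \<ge> 0" by (simp_all add: a_def b_def)
  have "norm (F z) * (a - b) * (a + b) \<le> norm (F (\<i> * s)) * (a + b) * (a + b)"
    using half_plane_growth[OF assms(1,2) s z] nn
    by (intro mult_right_mono) (auto simp: a_def b_def)
  then have "norm (F z) * (4 * s * Im z) \<le> norm (F (\<i> * s)) * (a + b)\<^sup>2"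
    unfolding ab[symmetric] by (simp add: algebra_simps power2_eq_square)
  also have "\<dots> \<le> norm (F (\<i> * s)) * (2 * (norm z + s))\<^sup>2"
    using le nn by (intro mult_left_mono power_mono) auto
  finally show ?thesis
    using s z by (simp add: field_simps power2_eq_square)
qed

section \<open>Alternating products of real linear factors\<close>

definition alternating :: "real set \<Rightarrow> (real \<Rightarrow> int) \<Rightarrow> bool" where
  "alternating X \<sigma> \<longleftrightarrow> (\<forall>x\<in>X. \<sigma> x = 1 \<or> \<sigma> x = - 1) \<and>
     (\<forall>x\<in>X. \<forall>y\<in>X. x < y \<and> \<sigma> x = \<sigma> y \<longrightarrow> (\<exists>w\<in>X. x < w \<and> w < y \<and> \<sigma> w \<noteq> \<sigma> x))"

lemma alternating_Int_Icc:
  assumes "alternating X \<sigma>"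
  shows "alternating (X \<inter> {a..b}) \<sigma>"
  unfolding alternating_def
proof (intro conjI ballI impI)
  fix x y assume *: "x \<in> X \<inter> {a..b}" "y \<in> X \<inter> {a..b}" "x < y \<and> \<sigma> x = \<sigma> y"
  with assms obtain w where "w \<in> X" "x < w" "w < y" "\<sigma> w \<noteq> \<sigma> x"
    unfolding alternating_def by blast
  with * show "\<exists>w\<in>X \<inter> {a..b}. x < w \<and> w < y \<and> \<sigma> w \<noteq> \<sigma> x"
    by (intro bexI[of _ w]) auto
qed (use assms in \<open>auto simp: alternating_def\<close>)

text \<open>
  A telescoping sum: the terms alternate in sign and, for monotone \<open>\<theta>\<close>, grow in size, so the
  last one decides the sign and bounds the sum. This is applied to \<open>\<theta> x = Arg (z - x)\<close>.
\<close>

lemma alternating_sum_bounds: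
  fixes \<theta> :: "real \<Rightarrow> real"
  assumes "finite X" "X \<noteq> {}" "alternating X \<sigma>"
    and mono: "\<And>x y. x \<le> y \<Longrightarrow> \<theta> x \<le> \<theta> y" and nonneg: "\<And>x. 0 \<le> \<theta> x"
  shows "0 \<le> of_int (\<sigma> (Max X)) * (\<Sum>x\<in>X. of_int (\<sigma> x) * \<theta> x) \<and>
         of_int (\<sigma> (Max X)) * (\<Sum>x\<in>X. of_int (\<sigma> x) * \<theta> x) \<le> \<theta> (Max X)"
  using assms(1-3)
proof (induction X rule: finite_linorder_max_induct)
  case (insert b A)
  have b: "\<sigma> b = 1 \<or> \<sigma> b = - 1"
    using insert.prems by (auto simp: alternating_def)
  have "b \<notin> A" using insert.hyps by auto
  have Max: "Max (insert b A) = b"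
    using insert.hyps by (intro Max_eqI) auto
  show ?case
  proof (cases "A = {}")
    case True
    then show ?thesis using b nonneg[of b] by auto
  next
    case False
    define M where "M = Max A"
    define S where "S = (\<Sum>x\<in>A. of_int (\<sigma> x) * \<theta> x)"
    have M: "M \<in> A" "\<And>x. x \<in> A \<Longrightarrow> x \<le> M" "M < b"
      using insert.hyps False by (auto simp: M_def)
    have alt: "alternating A \<sigma>"
    proof -
      have "A = insert b A \<inter> {Min A..M}"
        using M insert.hyps by auto
      then show ?thesis
        using alternating_Int_Icc[OF insert.prems(2)] by metis
    qed
    have IH: "0 \<le> of_int (\<sigma> M) * S" "of_int (\<sigma> M) * S \<le> \<theta> M"
      using insert.IH[OF False alt] by (auto simp: M_def S_def)
    have "\<sigma> M \<noteq> \<sigma> b"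
    proof
      assume "\<sigma> M = \<sigma> b"
      then obtain w where "w \<in> insert b A" "M < w" "w < b"
        using insert.prems M unfolding alternating_def by blast
      then show False using M(2) by force
    qed
    then have "\<sigma> M = - \<sigma> b"
      using b insert.prems M unfolding alternating_def by auto
    moreover have "(\<Sum>x\<in>insert b A. of_int (\<sigma> x) * \<theta> x) = of_int (\<sigma> b) * \<theta> b + S"
      using \<open>b \<notin> A\<close> insert.hyps by (simp add: S_def)
    moreover have "\<theta> M \<le> \<theta> b" using M mono by auto
    ultimately show ?thesis
      unfolding Max using b IH by (auto simp: algebra_simps)
  qed
qed auto

definition rational_prod :: "(real \<Rightarrow> int) \<Rightarrow> real set \<Rightarrow> complex \<Rightarrow> complex" where
  "rational_prod \<sigma> X z = (\<Prod>x\<in>X. (z - of_real x) powi \<sigma> x)"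

lemma rational_prod_nonzero:
  "Im z \<noteq> 0 \<Longrightarrow> rational_prod \<sigma> X z \<noteq> 0"
  by (cases "finite X") (auto simp: rational_prod_def dest: arg_cong[of _ _ Im])

lemma rational_prod_holomorphic:
  "rational_prod \<sigma> X holomorphic_on {z. Im z > 0}"
  unfolding rational_prod_def by (intro holomorphic_intros) (auto dest: arg_cong[of _ _ Im])

lemma rational_prod_cnj:
  "rational_prod \<sigma> X (cnj z) = cnj (rational_prod \<sigma> X z)"
  by (simp add: rational_prod_def)

lemma minus_real_eq_cis:
  assumes "Im z > 0"
  shows "z - of_real x = of_real (norm (z - of_real x)) * cis (pi / 2 - arctan ((Re z - x) / Im z))"
proof -
  define u where "u = (Re z - x) / Im z"
  have u: "Re z - x = Im z * u" using assms by (simp add: u_def)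
  have sq: "sqrt (1 + u\<^sup>2) > 0"
    by (simp add: add_pos_nonneg)
  have "(norm (z - of_real x))\<^sup>2 = (Im z)\<^sup>2 * (1 + u\<^sup>2)"
    by (simp only: cmod_power2 minus_complex.sel Re_complex_of_real Im_complex_of_real u)
       (simp add: power_mult_distrib distrib_left)
  then have "norm (z - of_real x) = sqrt ((Im z)\<^sup>2 * (1 + u\<^sup>2))"
    by (metis norm_ge_zero real_sqrt_unique)
  then have norm: "norm (z - of_real x) = Im z * sqrt (1 + u\<^sup>2)"
    using assms by (simp add: real_sqrt_mult)
  have "cis (pi / 2 - arctan u) = Complex (u / sqrt (1 + u\<^sup>2)) (1 / sqrt (1 + u\<^sup>2))"
    by (simp add: complex_eq_iff cos_diff sin_diff cos_arctan sin_arctan)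
  then have "of_real (norm (z - of_real x)) * cis (pi / 2 - arctan u) = Complex (Im z * u) (Im z)"
    unfolding norm using sq by (simp add: complex_eq_iff)
  also have "\<dots> = z - of_real x"
    by (simp add: complex_eq_iff u)
  finally show ?thesis by (simp add: u_def)
qed

lemma rational_prod_eq_cis:
  assumes z: "Im z > 0" and X: "finite X"
  shows "rational_prod \<sigma> X z = of_real (\<Prod>x\<in>X. norm (z - of_real x) powi \<sigma> x) *
           cis (\<Sum>x\<in>X. of_int (\<sigma> x) * (pi / 2 - arctan ((Re z - x) / Im z)))"
proof -
  have "rational_prod \<sigma> X z = (\<Prod>x\<in>X. of_real (norm (z - of_real x) powi \<sigma> x) *
           cis (of_int (\<sigma> x) * (pi / 2 - arctan ((Re z - x) / Im z))))"
    unfolding rational_prod_def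
  proof (rule prod.cong)
    fix x
    have "(z - of_real x) powi \<sigma> x = (of_real (norm (z - of_real x)) * cis (pi / 2 - arctan ((Re z - x) / Im z))) powi \<sigma> x"
      by (rule arg_cong[OF minus_real_eq_cis[OF z]])
    also have "(of_real r * cis t) powi k = of_real (r powi k) * cis (of_int k * t)" for r t k
      by (simp add: power_int_mult_distrib cis_power_int)
    finally show "(z - of_real x) powi \<sigma> x = of_real (norm (z - of_real x) powi \<sigma> x) *
           cis (of_int (\<sigma> x) * (pi / 2 - arctan ((Re z - x) / Im z)))"
      .
  qed simp
  also have "\<dots> = of_real (\<Prod>x\<in>X. norm (z - of_real x) powi \<sigma> x) *
           (\<Prod>x\<in>X. cis (of_int (\<sigma> x) * (pi / 2 - arctan ((Re z - x) / Im z))))"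
    by (simp add: prod.distrib)
  also have "(\<Prod>x\<in>X. cis (of_int (\<sigma> x) * (pi / 2 - arctan ((Re z - x) / Im z)))) =
     cis (\<Sum>x\<in>X. of_int (\<sigma> x) * (pi / 2 - arctan ((Re z - x) / Im z)))"
    using X
  proof induction
    case (insert x F)
    then show ?case
      by (simp only: prod.insert[OF insert.hyps] sum.insert[OF insert.hyps] insert.IH cis_mult)
  qed simp
  finally show ?thesis .
qed

text \<open>
  The argument of the product is the alternating sum of the arguments of its factors, hence lies
  in \<open>[0, \<pi>]\<close> or in \<open>[- \<pi>, 0]\<close>, depending only on whether the largest point is a
  zero or a pole. So up to sign the product maps the upper half-plane into its closure, and the
  growth estimates for such maps hold for it and its reciprocal with constants that do not depend
  on the number of factors.
\<close>

lemma rational_prod_Im_sign: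
  assumes "finite X" "alternating X \<sigma>"
  obtains \<epsilon> :: real where "\<epsilon> = 1 \<or> \<epsilon> = - 1" "\<And>z. Im z > 0 \<Longrightarrow> 0 \<le> Im (of_real \<epsilon> * rational_prod \<sigma> X z)"
proof (cases "X = {}")
  case True
  then show ?thesis by (intro that[of 1]) (auto simp: rational_prod_def)
next
  case False
  define \<epsilon> :: int where "\<epsilon> = \<sigma> (Max X)"
  have "Max X \<in> X" using assms False by simp
  then have \<epsilon>: "\<epsilon> = 1 \<or> \<epsilon> = - 1"
    using assms(2) by (auto simp: alternating_def \<epsilon>_def)
  have "0 \<le> Im (of_real (of_int \<epsilon>) * rational_prod \<sigma> X z)" if z: "Im z > 0" for z
  proof -
    define \<theta> where "\<theta> = (\<lambda>x. pi / 2 - arctan ((Re z - x) / Im z))"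
    define S where "S = (\<Sum>x\<in>X. of_int (\<sigma> x) * \<theta> x)"
    have bd: "0 \<le> of_int \<epsilon> * S \<and> of_int \<epsilon> * S \<le> \<theta> (Max X)"
      unfolding S_def \<epsilon>_def
    proof (rule alternating_sum_bounds[OF assms(1) False assms(2)])
      show "\<theta> x \<le> \<theta> y" if "x \<le> y" for x y
        using that z by (auto simp: \<theta>_def arctan_le_iff divide_right_mono)
      show "0 \<le> \<theta> x" for x
        using arctan_ubound[of "(Re z - x) / Im z"] by (simp add: \<theta>_def)
    qed
    have "\<theta> (Max X) \<le> pi"
      using arctan_lbound[of "(Re z - Max X) / Im z"] by (simp add: \<theta>_def)
    with bd have "0 \<le> sin (of_int \<epsilon> * S)"
      by (intro sin_ge_zero) auto
    then have "0 \<le> of_int \<epsilon> * sin S" using \<epsilon> by auto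
    then have "0 \<le> (\<Prod>x\<in>X. norm (z - of_real x) powi \<sigma> x) * (of_int \<epsilon> * sin S)"
      by (simp only: mult_nonneg_nonneg prod_nonneg norm_ge_zero zero_le_power_int)
    moreover have "Im (of_real (of_int \<epsilon>) * rational_prod \<sigma> X z) =
        (\<Prod>x\<in>X. norm (z - of_real x) powi \<sigma> x) * (of_int \<epsilon> * sin S)"
    proof -
      define P where "P = (\<Prod>x\<in>X. norm (z - of_real x) powi \<sigma> x)"
      have "rational_prod \<sigma> X z = of_real P * cis S"
        unfolding P_def S_def \<theta>_def by (rule rational_prod_eq_cis[OF z assms(1)])
      then show ?thesis unfolding P_def[symmetric] by simp
    qed
    ultimately show ?thesis
      by (simp only:)
  qed
  then show ?thesis using \<epsilon> by (intro that[of "of_int \<epsilon>"]) auto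
qed

lemma rational_prod_growth_axis:
  assumes "finite X" "alternating X \<sigma>" "0 < s" "s \<le> y"
  shows "norm (rational_prod \<sigma> X (\<i> * of_real y)) \<le> y / s * norm (rational_prod \<sigma> X (\<i> * of_real s))"
proof -
  obtain \<epsilon> :: real where \<epsilon>: "\<epsilon> = 1 \<or> \<epsilon> = - 1"
    "\<And>z. Im z > 0 \<Longrightarrow> 0 \<le> Im (of_real \<epsilon> * rational_prod \<sigma> X z)"
    using rational_prod_Im_sign[OF assms(1,2)] by blast
  have "norm (of_real \<epsilon> * rational_prod \<sigma> X (\<i> * of_real y))
       \<le> y / s * norm (of_real \<epsilon> * rational_prod \<sigma> X (\<i> * of_real s))"
    by (rule half_plane_growth_axis)
       (use \<epsilon> assms in \<open>auto intro!: holomorphic_intros rational_prod_holomorphic\<close>)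
  then show ?thesis using \<epsilon>(1) by (auto simp: norm_mult)
qed

lemma rational_prod_lower_bound:
  assumes "finite X" "alternating X \<sigma>" "0 < s" "Im z \<noteq> 0"
  shows "norm (rational_prod \<sigma> X (\<i> * of_real s))
       \<le> (norm z + s)\<^sup>2 / (s * \<bar>Im z\<bar>) * norm (rational_prod \<sigma> X z)"
proof -
  obtain \<epsilon> :: real where \<epsilon>: "\<epsilon> = 1 \<or> \<epsilon> = - 1"
    "\<And>z. Im z > 0 \<Longrightarrow> 0 \<le> Im (of_real \<epsilon> * rational_prod \<sigma> X z)"
    using rational_prod_Im_sign[OF assms(1,2)] by blast
  have *: "norm (rational_prod \<sigma> X (\<i> * of_real s))
       \<le> (norm z + s)\<^sup>2 / (s * Im z) * norm (rational_prod \<sigma> X z)" if z: "Im z > 0" for z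
  proof -
    have le: "norm (- (of_real \<epsilon> / rational_prod \<sigma> X z))
       \<le> (norm z + s)\<^sup>2 / (s * Im z) * norm (- (of_real \<epsilon> / rational_prod \<sigma> X (\<i> * of_real s)))"
    proof (rule half_plane_growth_poly)
      fix z assume "Im z > 0"
      have "Im (- (of_real \<epsilon> / rational_prod \<sigma> X z)) =
             Im (of_real \<epsilon> * rational_prod \<sigma> X z) / (norm (rational_prod \<sigma> X z))\<^sup>2"
        by (subst complex_div_cnj) (simp only: Im_divide_of_real uminus_complex.sel, simp)
      with \<epsilon>(2)[OF \<open>Im z > 0\<close>] show "0 \<le> Im (- (of_real \<epsilon> / rational_prod \<sigma> X z))"
        by simp
    next
      show "(\<lambda>z. - (of_real \<epsilon> / rational_prod \<sigma> X z)) holomorphic_on {z. 0 < Im z}"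
        by (intro holomorphic_intros rational_prod_holomorphic) (simp add: rational_prod_nonzero)
    qed (use z assms in auto)
    have inv: "norm (- (of_real \<epsilon> / rational_prod \<sigma> X w)) = 1 / norm (rational_prod \<sigma> X w)" for w
      using \<epsilon>(1) by (auto simp: norm_divide)
    have *: "b \<le> k * a" if "1 / a \<le> k * (1 / b)" "a > 0" "b > 0" for a b k :: real
      using that by (simp add: field_simps)
    show ?thesis
      by (rule *[OF le[unfolded inv]]) (use z assms(3) in \<open>auto simp: rational_prod_nonzero\<close>)
  qed
  show ?thesis
  proof (cases "Im z > 0")
    case True
    then show ?thesis using * by simp
  next
    case False
    then show ?thesis using *[of "cnj z"] assms(4) by (simp add: rational_prod_cnj)
  qed
qed

section \<open>Functions without zeros in a disc\<close>

lemma remove_sings_zorder_0: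
  assumes "f meromorphic_on {z}" "\<exists>\<^sub>F w in at z. f w \<noteq> 0" "zorder f z = 0"
  shows "remove_sings f analytic_on {z} \<and> remove_sings f z \<noteq> 0"
proof -
  have iso: "isolated_singularity_at f z" "not_essential f z"
    using assms(1) by (auto simp: meromorphic_at_iff)
  obtain r where r: "r > 0" "zor_poly f z z \<noteq> 0" "zor_poly f z holomorphic_on cball z r"
    "\<And>w. w \<in> cball z r - {z} \<Longrightarrow> f w = zor_poly f z w * (w - z) powi zorder f z"
    using zorder_exist[OF iso assms(2)] by blast
  have "isCont (zor_poly f z) z"
    using r by (intro continuous_on_interior[OF holomorphic_on_imp_continuous_on[OF r(3)]]) auto
  then have "zor_poly f z \<midarrow>z\<rightarrow> zor_poly f z z"
    by (simp add: isCont_def)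
  moreover have "\<forall>\<^sub>F w in at z. f w = zor_poly f z w"
    using eventually_at_in_open[of "ball z r" z] r assms(3) by (auto elim!: eventually_mono)
  ultimately have lim: "f \<midarrow>z\<rightarrow> zor_poly f z z"
    using tendsto_cong by force
  show ?thesis
    using remove_sings_analytic_at[OF iso(1) lim] remove_sings_eqI[OF lim] r by auto
qed

text \<open>
  A bound that blows up like a power of \<open>1 / \<bar>Im z\<bar>\<close> at the two real points of a circle
  still controls \<open>H\<close> inside: on the circle \<open>\<bar>z\<^sup>2 - r\<^sup>2\<bar> = 2 r \<bar>Im z\<bar>\<close>, so
  multiplication by \<open>(z\<^sup>2 - r\<^sup>2)\<close> to the power \<open>J\<close> removes the blow-up, and the maximum
  principle applies to the product.
\<close>

lemma norm_le_of_bound_on_nonreal_circle: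
  fixes H :: "complex \<Rightarrow> complex"
  assumes holo: "H holomorphic_on cball 0 r" and r: "1 \<le> r"
    and bound: "\<And>z. norm z = r \<Longrightarrow> Im z \<noteq> 0 \<Longrightarrow> norm (H z) * \<bar>Im z\<bar> ^ J \<le> B"
    and J: "J > 0" and B: "B \<ge> 0" and z: "norm z \<le> r / 2"
  shows "norm (H z) \<le> B * 4 ^ J"
proof -
  define g where "g = (\<lambda>z. H z * (z\<^sup>2 - of_real (r\<^sup>2)) ^ J)"
  have circle: "norm (g z) \<le> B * (2 * r) ^ J" if z: "norm z = r" for z
  proof (cases "Im z = 0")
    case True
    then have "z = of_real (Re z)" by (simp add: complex_eq_iff)
    have "r\<^sup>2 = (Re z)\<^sup>2"
      unfolding z[symmetric] cmod_power2 using True by simp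
    then have "z\<^sup>2 = of_real (r\<^sup>2)"
      by (subst \<open>z = of_real (Re z)\<close>) simp
    then show ?thesis using J B r by (simp add: g_def power_0_left)
  next
    case False
    have "z\<^sup>2 - of_real (r\<^sup>2) = z * (z - cnj z)"
      unfolding z[symmetric] complex_norm_square by (simp add: power2_eq_square algebra_simps)
    then have "norm (z\<^sup>2 - of_real (r\<^sup>2)) = 2 * r * \<bar>Im z\<bar>"
      using z by (simp add: complex_diff_cnj norm_mult)
    then have "norm (g z) = (norm (H z) * \<bar>Im z\<bar> ^ J) * (2 * r) ^ J"
      by (simp add: g_def norm_mult norm_power power_mult_distrib)
    also have "\<dots> \<le> B * (2 * r) ^ J"
      using bound[OF z False] r by (intro mult_right_mono) auto
    finally show ?thesis .
  qed
  have holo_g: "g holomorphic_on cball 0 r"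
    unfolding g_def by (intro holomorphic_intros holo)
  have "norm (g z) \<le> B * (2 * r) ^ J"
  proof (rule maximum_modulus_frontier[of g "cball 0 r"])
    show "g holomorphic_on interior (cball 0 r)"
      using holo_g holomorphic_on_subset interior_subset by blast
    show "continuous_on (closure (cball 0 r)) g"
      using holomorphic_on_imp_continuous_on[OF holo_g] by simp
  qed (use circle z r in auto)
  moreover have "(r\<^sup>2 / 2) ^ J \<le> norm ((z\<^sup>2 - of_real (r\<^sup>2)) ^ J)"
  proof -
    have "(norm z)\<^sup>2 \<le> (r / 2)\<^sup>2" using z by (intro power_mono) auto
    moreover have "norm (of_real (r\<^sup>2) :: complex) - norm (z\<^sup>2) \<le> norm (z\<^sup>2 - of_real (r\<^sup>2))"
      by (metis norm_minus_commute norm_triangle_ineq2)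
    moreover have "norm (of_real (r\<^sup>2) :: complex) = r\<^sup>2" "norm (z\<^sup>2) = (norm z)\<^sup>2" "(r / 2)\<^sup>2 = r\<^sup>2 / 4"
      by (simp_all add: norm_power power_divide)
    ultimately have "r\<^sup>2 / 2 \<le> norm (z\<^sup>2 - of_real (r\<^sup>2))"
      using zero_le_power2[of r] by linarith
    then show ?thesis unfolding norm_power by (intro power_mono) auto
  qed
  ultimately have "norm (H z) * (r\<^sup>2 / 2) ^ J \<le> B * (2 * r) ^ J"
    unfolding g_def norm_mult by (meson mult_left_mono norm_ge_zero order_trans)
  also have "\<dots> \<le> B * (2 * r\<^sup>2) ^ J"
    using r B by (intro mult_left_mono power_mono) (auto simp: power2_eq_square)
  also have "2 * r\<^sup>2 = 4 * (r\<^sup>2 / 2)" by simp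
  finally show ?thesis
    using r unfolding power_mult_distrib by (simp add: mult.assoc[symmetric])
qed

text \<open>
  Harnack's inequality for the nonnegative harmonic function \<open>ln M - ln \<bar>H\<bar>\<close>, obtained from
  Caratheodory's inequality for a branch of the logarithm. When \<open>M\<close> grows polynomially in the
  radius, it says that \<open>\<bar>H\<bar>\<close> hardly varies near the centre of a large disc.
\<close>

lemma nonvanishing_harnack:
  fixes H :: "complex \<Rightarrow> complex"
  assumes holo: "H holomorphic_on ball c R" and nz: "\<And>z. z \<in> ball c R \<Longrightarrow> H z \<noteq> 0"
    and bound: "\<And>z. z \<in> ball c R \<Longrightarrow> norm (H z) \<le> M"
    and z: "z \<in> ball c R"
  shows "norm (H z) \<le> norm (H c) * exp (2 * ln (M / norm (H c)) * norm (z - c) / (R - norm (z - c)))"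
proof -
  have c: "c \<in> ball c R"
    using z order_le_less_trans[OF zero_le_dist] by auto
  have "M > 0" using nz[OF c] bound[OF c] by (meson less_le_trans zero_less_norm_iff)
  obtain g where g: "g holomorphic_on ball c R" "\<And>z. z \<in> ball c R \<Longrightarrow> H z = exp (g z)"
    using contractible_imp_holomorphic_log[OF holo convex_imp_contractible[OF convex_ball] nz] by blast
  have Re_g: "Re (g z) = ln (norm (H z))" if "z \<in> ball c R" for z
    using g(2)[OF that] by simp
  have le: "norm ((of_real (ln M) - g z) - (of_real (ln M) - g c))
      \<le> 2 * Re (of_real (ln M) - g c) * norm (z - c) / (R - norm (z - c))"
  proof (rule caratheodory_disc[where F = "\<lambda>z. of_real (ln M) - g z", OF _ _ z])
    fix z assume z: "z \<in> ball c R"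
    then show "0 \<le> Re (of_real (ln M) - g z)"
      using Re_g[OF z] nz[OF z] bound[OF z] \<open>M > 0\<close> by (simp add: ln_le_cancel_iff)
  qed (intro holomorphic_intros g)
  have Re_c: "Re (of_real (ln M) - g c) = ln (M / norm (H c))"
    using Re_g[OF c] nz[OF c] \<open>M > 0\<close> by (simp add: ln_div)
  have "Re (g z - g c) \<le> norm ((of_real (ln M) - g z) - (of_real (ln M) - g c))"
    using complex_Re_le_cmod[of "g z - g c"] by (simp add: norm_minus_commute)
  then have "Re (g z) - Re (g c) \<le> 2 * ln (M / norm (H c)) * norm (z - c) / (R - norm (z - c))"
    using le[unfolded Re_c] by simp
  then have "Re (g z) \<le> Re (g c) + 2 * ln (M / norm (H c)) * norm (z - c) / (R - norm (z - c))"
    by simp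
  then have "exp (Re (g z)) \<le> exp (Re (g c) + 2 * ln (M / norm (H c)) * norm (z - c) / (R - norm (z - c)))"
    by simp
  then show ?thesis
    using g(2)[OF z] g(2)[OF c] by (simp add: exp_add)
qed

lemma zorder_linear_power_int:
  "zorder (\<lambda>w. (w - a) powi k) z = (if z = a then k else 0)"
proof (cases "z = a")
  case True
  then show ?thesis
    by (intro zorder_eqI[where S = UNIV and g = "\<lambda>_. 1"]) auto
next
  case False
  then show ?thesis
    by (simp, intro zorder_eq_0I analytic_intros) auto
qed

lemma eventually_prod_linear_nonzero:
  fixes z :: complex
  assumes "finite S"
  shows "\<forall>\<^sub>F w in at z. (\<Prod>a\<in>S. (w - a) powi k a) \<noteq> 0"
proof -
  have "\<forall>\<^sub>F w in at z. w \<notin> S"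
    using islimpt_finite[OF assms, of z] by (simp add: islimpt_iff_eventually)
  then show ?thesis
    by eventually_elim (use assms in auto)
qed

lemma zorder_prod_linear_power_int:
  assumes "finite S"
  shows "zorder (\<lambda>w. \<Prod>a\<in>S. (w - a) powi k a) z = (if z \<in> S then k z else 0)"
proof -
  have "zorder (\<lambda>w. \<Prod>a\<in>S. (w - a) powi k a) z = (\<Sum>a\<in>S. zorder (\<lambda>w. (w - a) powi k a) z)"
    by (rule zorder_prod) (intro meromorphic_intros eventually_prod_linear_nonzero assms)+
  also have "\<dots> = (\<Sum>a\<in>S. if z = a then k a else 0)"
    by (simp only: zorder_linear_power_int)
  finally show ?thesis
    using assms by simp
qed

section \<open>Growth on the imaginary axis read off from the divisor\<close>

lemma rational_prod_altdef:
  "rational_prod \<sigma> X z = (\<Prod>a\<in>of_real ` X. (z - a) powi \<sigma> (Re a))"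
  unfolding rational_prod_def by (subst prod.reindex) (auto simp: inj_on_def)

lemma eventually_log_le_linear:
  fixes a t :: real
  shows "\<forall>\<^sub>F r in at_top. 2 * (a + real p * ln (2 * r)) * t \<le> r / 4 - t"
proof -
  have "((\<lambda>r. (2 * (a + real p * ln (2 * r)) * t + t) / r) \<longlongrightarrow> 0) at_top"
    by real_asymp
  then have "\<forall>\<^sub>F r in at_top. (2 * (a + real p * ln (2 * r)) * t + t) / r < 1 / 4"
    by (rule order_tendstoD) simp
  then show ?thesis
    using eventually_gt_at_top[of 0] by eventually_elim (simp add: field_simps)
qed

text \<open>
  \<open>X\<close> carries an alternating sequence of simple zeros and poles, and \<open>E\<close> finitely many further
  zeros. For a large disc of radius \<open>2 r\<close>, divide \<open>N\<close> by the alternating product \<open>\<psi>\<close> over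
  the points of \<open>X\<close> in the disc and by the polynomial \<open>P\<close> with the zeros \<open>E\<close>. The
  quotient \<open>H\<close> has no zeros or poles in the disc and, normalised by the value of \<open>\<psi>\<close> at
  \<open>\<i> s\<close>, is polynomially bounded in \<open>r\<close>; by Harnack's inequality it is almost constant
  near the imaginary segment up to \<open>\<i> y\<close> once \<open>r\<close> is large. Thus \<open>N\<close> grows there no
  faster than \<open>P\<close> times the at most linear \<open>\<psi>\<close>. Working with finite products for each
  \<open>y\<close> separately avoids the infinite product over all of \<open>X\<close>.
\<close>

theorem growth_from_alternating_divisor:
  fixes N :: "complex \<Rightarrow> complex" and X :: "real set" and E :: "complex set" and e :: "complex \<Rightarrow> nat"
  assumes mero: "N meromorphic_on UNIV"
    and ana: "\<And>z. Im z \<noteq> 0 \<Longrightarrow> N analytic_on {z}"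
    and nz: "\<And>z. \<exists>\<^sub>F w in at z. N w \<noteq> 0"
    and alt: "alternating X \<sigma>" and fin: "\<And>R. finite (X \<inter> {-R..R})"
    and E: "finite E"
    and zorder: "\<And>z. zorder N z = (if z \<in> of_real ` X then \<sigma> (Re z) else 0) + (if z \<in> E then int (e z) else 0)"
    and bound: "\<And>z. Im z \<noteq> 0 \<Longrightarrow> norm (N z) \<le> C * (1 + norm z) ^ K / \<bar>Im z\<bar> ^ j"
  shows "\<exists>C s. 0 < s \<and> (\<forall>y\<ge>s. norm (N (\<i> * of_real y)) \<le> C * y ^ (sum e E + 1))"
proof -
  define P where "P = (\<lambda>z. \<Prod>a\<in>E. (z - a) powi int (e a))"
  \<comment> \<open>Beyond radius \<open>s\<close> every factor of \<open>P\<close> has norm at least 1.\<close>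
  define s where "s = 1 + (\<Sum>a\<in>E. norm a)"
  have norm_E: "norm a \<le> s - 1" if "a \<in> E" for a
    using member_le_sum[OF that, of norm] E by (simp add: s_def)
  have s: "s \<ge> 1" by (simp add: s_def sum_nonneg)
  have P_lower: "norm (P z) \<ge> 1" if "norm z \<ge> s" for z
  proof -
    have "1 \<le> norm (z - a)" if "a \<in> E" for a
      using norm_triangle_ineq2[of z a] norm_E[OF that] \<open>norm z \<ge> s\<close> by linarith
    then have "1 \<le> (\<Prod>a\<in>E. norm (z - a) ^ e a)"
      by (intro prod_ge_1 one_le_power)
    then show ?thesis by (simp add: P_def prod_norm[symmetric] norm_power)
  qed
  have P_upper: "norm (P z) \<le> (2 * norm z) ^ sum e E" if "norm z \<ge> s" for z
  proof -
    have "norm (P z) = (\<Prod>a\<in>E. norm (z - a) ^ e a)"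
      by (simp add: P_def prod_norm[symmetric] norm_power)
    also have "\<dots> \<le> (\<Prod>a\<in>E. (2 * norm z) ^ e a)"
    proof (intro prod_mono conjI power_mono)
      fix a assume "a \<in> E"
      show "norm (z - a) \<le> 2 * norm z"
        using norm_triangle_ineq4[of z a] norm_E[OF \<open>a \<in> E\<close>] that by linarith
    qed auto
    finally show ?thesis by (simp add: power_sum)
  qed
  have not_E: "z \<notin> E" if "norm z \<ge> s" for z
    using norm_E[of z] that by force
  have W_zorder: "zorder (\<lambda>w. rational_prod \<sigma> Y w * P w) z =
      (if z \<in> of_real ` Y then \<sigma> (Re z) else 0) + (if z \<in> E then int (e z) else 0)"
    and W_nz: "\<exists>\<^sub>F w in at z. rational_prod \<sigma> Y w * P w \<noteq> 0"
    and W_mero: "(\<lambda>w. rational_prod \<sigma> Y w * P w) meromorphic_on {z}"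
    if Y: "finite Y" for Y z
  proof -
    have ev1: "\<forall>\<^sub>F w in at z. rational_prod \<sigma> Y w \<noteq> 0"
      unfolding rational_prod_altdef by (rule eventually_prod_linear_nonzero) (use Y in auto)
    have ev2: "\<forall>\<^sub>F w in at z. P w \<noteq> 0"
      unfolding P_def by (rule eventually_prod_linear_nonzero) (use E in auto)
    have m1: "rational_prod \<sigma> Y meromorphic_on {z}"
      unfolding rational_prod_def by (intro meromorphic_intros)
    have m2: "P meromorphic_on {z}"
      unfolding P_def by (intro meromorphic_intros)
    show "(\<lambda>w. rational_prod \<sigma> Y w * P w) meromorphic_on {z}"
      by (intro meromorphic_intros m1 m2)
    have "\<forall>\<^sub>F w in at z. rational_prod \<sigma> Y w * P w \<noteq> 0"
      using ev1 ev2 by eventually_elim simp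
    then show "\<exists>\<^sub>F w in at z. rational_prod \<sigma> Y w * P w \<noteq> 0"
      by (intro eventually_frequently) auto
    have "zorder (\<lambda>w. rational_prod \<sigma> Y w * P w) z = zorder (rational_prod \<sigma> Y) z + zorder P z"
      by (rule zorder_mult) (use m1 m2 ev1 ev2 in \<open>auto intro: eventually_frequently\<close>)
    also have "zorder (rational_prod \<sigma> Y) z = (if z \<in> of_real ` Y then \<sigma> (Re z) else 0)"
      unfolding rational_prod_altdef[abs_def] by (rule zorder_prod_linear_power_int) (use Y in auto)
    also have "zorder P z = (if z \<in> E then int (e z) else 0)"
      unfolding P_def by (rule zorder_prod_linear_power_int) (use E in auto)
    finally show "zorder (\<lambda>w. rational_prod \<sigma> Y w * P w) z =
      (if z \<in> of_real ` Y then \<sigma> (Re z) else 0) + (if z \<in> E then int (e z) else 0)" .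
  qed
  have N_s: "N (\<i> * of_real s) \<noteq> 0"
  proof -
    have "\<i> * of_real s \<notin> of_real ` X" using s by (auto simp: complex_eq_iff)
    moreover have "\<i> * of_real s \<notin> E" using s by (intro not_E) (simp add: norm_mult)
    ultimately have "zorder N (\<i> * of_real s) = 0" using zorder by simp
    then show ?thesis
      using zorder_eq_0_iff[OF ana nz, of "\<i> * of_real s"] s by simp
  qed
  have C: "C > 0"
  proof -
    have "0 < norm (N (\<i> * of_real s))" using N_s by simp
    also have "\<dots> \<le> C * (1 + s) ^ K / s ^ j"
      using bound[of "\<i> * of_real s"] s by (simp add: norm_mult)
    finally show ?thesis using s by (simp add: zero_less_divide_iff zero_less_mult_iff)
  qed
  define c0 where "c0 = norm (N (\<i> * of_real s)) / norm (P (\<i> * of_real s))"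
  have P_s: "norm (P (\<i> * of_real s)) \<ge> 1" using s by (intro P_lower) (simp add: norm_mult)
  have c0: "c0 > 0" unfolding c0_def using N_s P_s by (intro divide_pos_pos) auto
  define A where "A = C * 4 ^ (j + 1) / c0"
  have A: "A > 0" using C c0 by (simp add: A_def)
  have main: "norm (N (\<i> * of_real y)) \<le> c0 * exp 1 * 2 ^ sum e E * y ^ (sum e E + 1)" if y: "y \<ge> s" for y
  proof -
    \<comment> \<open>The second condition makes the exponent in Harnack's inequality at most 1.\<close>
    obtain r where r: "r \<ge> 4 * s + 4 * y"
      "2 * (ln A + real (K + 2) * ln (2 * r)) * (y - s) \<le> r / 4 - (y - s)"
      using eventually_happens'[OF _ eventually_conj[OF eventually_ge_at_top[of "4 * s + 4 * y"]
          eventually_log_le_linear[of "ln A" "K + 2" "y - s"]]] by auto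
    define Y where "Y = X \<inter> {- (2 * r)..2 * r}"
    have Y: "finite Y" "alternating Y \<sigma>"
      using fin alternating_Int_Icc[OF alt] by (auto simp: Y_def)
    define \<psi> where "\<psi> = rational_prod \<sigma> Y"
    define H where "H = remove_sings (\<lambda>w. N w / (\<psi> w * P w))"
    have H: "H analytic_on {z} \<and> H z \<noteq> 0" if z: "z \<in> ball 0 (2 * r)" for z
      unfolding H_def
    proof (rule remove_sings_zorder_0)
      have m: "N meromorphic_on {z}" using mero meromorphic_on_subset by blast
      show "(\<lambda>w. N w / (\<psi> w * P w)) meromorphic_on {z}"
        unfolding \<psi>_def by (intro meromorphic_intros m W_mero[OF Y(1)])
      have "\<forall>\<^sub>F w in at z. N w \<noteq> 0"
        using non_zero_neighbour m nz by (auto simp: meromorphic_at_iff)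
      moreover have "\<forall>\<^sub>F w in at z. \<psi> w * P w \<noteq> 0"
        unfolding \<psi>_def using W_mero[OF Y(1)] W_nz[OF Y(1)]
        by (intro non_zero_neighbour) (simp_all add: meromorphic_at_iff)
      ultimately have "\<forall>\<^sub>F w in at z. N w / (\<psi> w * P w) \<noteq> 0"
        by eventually_elim simp
      then show "\<exists>\<^sub>F w in at z. N w / (\<psi> w * P w) \<noteq> 0"
        by (intro eventually_frequently) auto
      have "zorder (\<lambda>w. N w / (\<psi> w * P w)) z = zorder N z - zorder (\<lambda>w. \<psi> w * P w) z"
        by (rule zorder_divide) (use m nz W_mero[OF Y(1)] W_nz[OF Y(1)] in \<open>auto simp: \<psi>_def\<close>)
      also have "z \<in> of_real ` X \<longleftrightarrow> z \<in> of_real ` Y"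
        using z by (auto simp: Y_def intro!: imageI)
      then have "zorder N z - zorder (\<lambda>w. \<psi> w * P w) z = 0"
        unfolding \<psi>_def W_zorder[OF Y(1)] zorder by simp
      finally show "zorder (\<lambda>w. N w / (\<psi> w * P w)) z = 0" .
    qed
    have H_holo: "H holomorphic_on ball 0 (2 * r)"
      using H analytic_on_analytic_at analytic_imp_holomorphic by blast
    have psi_ana: "\<psi> analytic_on {z}" if "Im z \<noteq> 0" for z
      unfolding \<psi>_def rational_prod_def using that
      by (intro analytic_intros) (auto dest: arg_cong[of _ _ Im])
    have H_eq: "H z = N z / (\<psi> z * P z)" if "Im z \<noteq> 0" "norm z \<ge> s" for z
      unfolding H_def
    proof (rule remove_sings_at_analytic)
      have "\<psi> z * P z \<noteq> 0"
        using rational_prod_nonzero[OF that(1)] P_lower[OF that(2)] by (auto simp: \<psi>_def)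
      then show "(\<lambda>w. N w / (\<psi> w * P w)) analytic_on {z}"
        by (intro analytic_intros ana psi_ana that) (auto simp: P_def intro!: analytic_intros)
    qed
    let ?is = "\<i> * complex_of_real s" and ?iy = "\<i> * complex_of_real y"
    have psi_s: "norm (\<psi> ?is) > 0"
      using rational_prod_nonzero[of ?is] s by (simp add: \<psi>_def)
    have r1: "1 \<le> r" "s \<le> r" "0 \<le> y" using r s y by auto
    \<comment> \<open>The lower bound for \<open>\<psi>\<close> costs two powers of \<open>r\<close> and one of \<open>\<bar>Im z\<bar>\<close>.\<close>
    define M where "M = C * (2 * r) ^ (K + 2) / norm (\<psi> ?is) * 4 ^ (j + 1)"
    have H_bound: "norm (H z) \<le> M" if "norm z \<le> r / 2" for z
      unfolding M_def
    proof (rule norm_le_of_bound_on_nonreal_circle[of H r])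
      show "H holomorphic_on cball 0 r"
        by (rule holomorphic_on_subset[OF H_holo]) (use r1 in auto)
      fix z assume z: "norm z = r" "Im z \<noteq> 0"
      have "norm (H z) * norm (\<psi> ?is) * \<bar>Im z\<bar> ^ (j + 1)
          = norm (N z) / norm (P z) * (norm (\<psi> ?is) / norm (\<psi> z)) * \<bar>Im z\<bar> ^ (j + 1)"
        using H_eq[of z] z r1 by (simp add: norm_divide norm_mult)
      also have "\<dots> \<le> (C * (1 + r) ^ K / \<bar>Im z\<bar> ^ j) / 1 * ((r + s)\<^sup>2 / (s * \<bar>Im z\<bar>)) * \<bar>Im z\<bar> ^ (j + 1)"
      proof (rule mult_right_mono[OF mult_mono[OF frac_le]])
        have "norm (\<psi> ?is) \<le> (r + s)\<^sup>2 / (s * \<bar>Im z\<bar>) * norm (\<psi> z)"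
          using rational_prod_lower_bound[OF Y, of s z] s z by (simp add: \<psi>_def)
        then show "norm (\<psi> ?is) / norm (\<psi> z) \<le> (r + s)\<^sup>2 / (s * \<bar>Im z\<bar>)"
          using rational_prod_nonzero[OF z(2)] by (simp add: \<psi>_def pos_divide_le_eq)
      qed (use bound[OF z(2)] z P_lower[of z] r1 s C in auto)
      also have "\<dots> = C * (1 + r) ^ K * ((r + s)\<^sup>2 / s)"
        using z(2) s by simp
      also have "\<dots> \<le> C * (2 * r) ^ K * ((2 * r)\<^sup>2 / 1)"
        using C s r1 by (intro mult_mono mult_left_mono power_mono frac_le) auto
      also have "\<dots> = C * (2 * r) ^ (K + 2)"
        by (simp only: power_add div_by_1 mult.assoc)
      finally show "norm (H z) * \<bar>Im z\<bar> ^ (j + 1) \<le> C * (2 * r) ^ (K + 2) / norm (\<psi> ?is)"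
        using psi_s by (simp add: pos_le_divide_eq mult_ac)
    qed (use that C r1 in auto)
    have c0_eq: "norm (\<psi> ?is) * norm (H ?is) = c0"
      using H_eq[of ?is] s psi_s by (simp add: norm_mult norm_divide c0_def)
    have H_s: "norm (H ?is) > 0" using c0_eq c0 psi_s by (metis mult_zero_right less_irrefl zero_less_norm_iff norm_zero)
    have "norm (H ?iy) \<le> norm (H ?is) *
        exp (2 * ln (M / norm (H ?is)) * norm (?iy - ?is) / (r / 4 - norm (?iy - ?is)))"
    proof (rule nonvanishing_harnack)
      have sub: "norm z \<le> r / 2" if "z \<in> ball ?is (r / 4)" for z
        using that norm_triangle_sub[of z ?is] s r y by (simp add: dist_norm norm_minus_commute norm_mult)
      then have sub2: "ball ?is (r / 4) \<subseteq> ball 0 (2 * r)" using r1 by force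
      show "H holomorphic_on ball ?is (r / 4)"
        by (rule holomorphic_on_subset[OF H_holo sub2])
      show "H z \<noteq> 0" if "z \<in> ball ?is (r / 4)" for z
        using H sub2 that by blast
      show "norm (H z) \<le> M" if "z \<in> ball ?is (r / 4)" for z
        using H_bound sub[OF that] by blast
      show "?iy \<in> ball ?is (r / 4)"
        using s r y by (simp add: dist_norm norm_mult flip: right_diff_distrib of_real_diff)
    qed
    also have "norm (?iy - ?is) = y - s"
      using y by (simp add: norm_mult flip: right_diff_distrib of_real_diff)
    also have "M / norm (H ?is) = A * (2 * r) ^ (K + 2)"
      unfolding M_def A_def c0_eq[symmetric] by simp
    also have "ln (A * (2 * r) ^ (K + 2)) = ln A + real (K + 2) * ln (2 * r)"
      using A r1 by (simp only: ln_mult_pos zero_less_power ln_realpow)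
    also have "2 * (ln A + real (K + 2) * ln (2 * r)) * (y - s) / (r / 4 - (y - s)) \<le> 1"
      using r s y by (simp only: divide_le_eq_1) auto
    then have "norm (H ?is) * exp (2 * (ln A + real (K + 2) * ln (2 * r)) * (y - s) / (r / 4 - (y - s)))
        \<le> norm (H ?is) * exp 1"
      by (intro mult_left_mono) auto
    finally have H_y: "norm (H ?iy) \<le> norm (H ?is) * exp 1" .
    have "norm (N ?iy) = norm (H ?iy) * norm (\<psi> ?iy) * norm (P ?iy)"
      using H_eq[of ?iy] y s rational_prod_nonzero[of ?iy \<sigma> Y] P_lower[of ?iy]
      by (auto simp: norm_mult norm_divide \<psi>_def)
    also have "\<dots> \<le> (norm (H ?is) * exp 1) * (y * norm (\<psi> ?is)) * (2 * y) ^ sum e E"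
    proof (intro mult_mono H_y)
      have "norm (\<psi> ?iy) \<le> y / s * norm (\<psi> ?is)"
        using rational_prod_growth_axis[OF Y, of s y] s y by (simp add: \<psi>_def)
      also have "\<dots> \<le> y * norm (\<psi> ?is)"
        using s y by (intro mult_right_mono) (auto simp: field_simps)
      finally show "norm (\<psi> ?iy) \<le> y * norm (\<psi> ?is)" .
      show "norm (P ?iy) \<le> (2 * y) ^ sum e E"
        using P_upper[of ?iy] s y by (simp add: norm_mult)
    qed (use y s in auto)
    also have "\<dots> = (norm (\<psi> ?is) * norm (H ?is)) * exp 1 * 2 ^ sum e E * y ^ (sum e E + 1)"
      by (simp add: power_mult_distrib)
    finally show ?thesis unfolding c0_eq .
  qed
  show ?thesis
    using main s by (intro exI[of _ "c0 * exp 1 * 2 ^ sum e E"] exI[of _ s]) auto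
qed

section \<open>Real zeros, derivatives and multiplicities\<close>

lemma has_real_derivative_Re_of_real:
  assumes "g field_differentiable at (of_real x)"
  shows "((\<lambda>t. Re (g (of_real t))) has_real_derivative Re (deriv g (of_real x))) (at x)"
    and "((\<lambda>t. Im (g (of_real t))) has_real_derivative Im (deriv g (of_real x))) (at x)"
proof -
  have "(g has_field_derivative deriv g (of_real x)) (at (of_real x))"
    using assms by (simp add: DERIV_deriv_iff_field_differentiable)
  then have d: "((\<lambda>t. g (of_real t)) has_vector_derivative deriv g (of_real x)) (at x)"
    by (rule has_vector_derivative_real_field)
  show "((\<lambda>t. Re (g (of_real t))) has_real_derivative Re (deriv g (of_real x))) (at x)"
    using bounded_linear.has_vector_derivative[OF bounded_linear_Re d]
    by (simp add: has_real_derivative_iff_has_vector_derivative)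
  show "((\<lambda>t. Im (g (of_real t))) has_real_derivative Im (deriv g (of_real x))) (at x)"
    using bounded_linear.has_vector_derivative[OF bounded_linear_Im d]
    by (simp add: has_real_derivative_iff_has_vector_derivative)
qed

lemma deriv_real_on_reals:
  fixes g :: "complex \<Rightarrow> complex"
  assumes "g field_differentiable at (of_real x)" "\<And>t. g (of_real t) \<in> \<real>"
  shows "deriv g (of_real x) \<in> \<real>"
proof -
  have "(\<lambda>t. Im (g (of_real t))) = (\<lambda>t. 0)"
    using assms(2) by (auto simp: complex_is_Real_iff)
  then have "Im (deriv g (of_real x)) = 0"
    using has_real_derivative_Re_of_real(2)[OF assms(1)] DERIV_unique[OF _ DERIV_const] by metis
  then show ?thesis by (simp add: complex_is_Real_iff)
qed

text \<open>
  Rolle's theorem for a complex function that is real on the real axis: the real part handles the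
  derivative in the usual way, and the imaginary part of the derivative vanishes there.
\<close>

lemma Rolle_real_on_reals:
  fixes g :: "complex \<Rightarrow> complex"
  assumes "a < b" and diff: "\<And>x. a \<le> x \<Longrightarrow> x \<le> b \<Longrightarrow> g field_differentiable at (of_real x)"
    and real: "\<And>t. g (of_real t) \<in> \<real>" and ends: "g (of_real a) = g (of_real b)"
  shows "\<exists>t. a < t \<and> t < b \<and> deriv g (of_real t) = 0"
proof -
  have der: "((\<lambda>t. Re (g (of_real t))) has_real_derivative Re (deriv g (of_real x))) (at x)"
    if "a \<le> x" "x \<le> b" for x
    using has_real_derivative_Re_of_real(1) diff that by blast
  have "\<exists>t. a < t \<and> t < b \<and> DERIV (\<lambda>t. Re (g (of_real t))) t :> 0"
  proof (rule Rolle[OF \<open>a < b\<close>])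
    show "continuous_on {a..b} (\<lambda>t. Re (g (of_real t)))"
      using der by (intro continuous_at_imp_continuous_on ballI DERIV_isCont[OF der]) auto
    show "(\<lambda>t. Re (g (of_real t))) differentiable at x" if "a < x" "x < b" for x
      using der[of x] that real_differentiable_def by auto
  qed (use ends in auto)
  then obtain t where t: "a < t" "t < b" "DERIV (\<lambda>t. Re (g (of_real t))) t :> 0" by blast
  then have "Re (deriv g (of_real t)) = 0"
    using der[of t] DERIV_unique by force
  moreover have "deriv g (of_real t) \<in> \<real>"
    using deriv_real_on_reals[OF diff real, of t] t by auto
  ultimately show ?thesis
    using t by (intro exI[of _ t]) (auto simp: complex_is_Real_iff complex_eq_iff)
qed

lemma entire_finite_zeros_Icc:
  assumes "g holomorphic_on UNIV" "\<exists>z. g z \<noteq> 0"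
  shows "finite {x::real. a \<le> x \<and> x \<le> b \<and> g (of_real x) = 0}"
proof (cases "g constant_on UNIV")
  case True
  then show ?thesis using assms(2) by (auto simp: constant_on_def)
next
  case False
  have "finite {z \<in> of_real ` {a..b}. g z = 0}"
    by (rule holomorphic_compact_finite_zeros[OF assms(1)])
       (use False in \<open>auto intro!: compact_continuous_image continuous_intros\<close>)
  then have "finite (Re ` {z \<in> of_real ` {a..b}. g z = 0})" by blast
  moreover have "{x::real. a \<le> x \<and> x \<le> b \<and> g (of_real x) = 0} \<subseteq> Re ` {z \<in> of_real ` {a..b}. g z = 0}"
    by (force simp: image_iff)
  ultimately show ?thesis by (rule finite_subset[rotated])
qed

lemma entire_frequently_nonzero:
  assumes "g holomorphic_on UNIV" "\<exists>z. g z \<noteq> (0::complex)"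
  shows "\<exists>\<^sub>F w in at z. g w \<noteq> 0"
proof -
  obtain z0 where "g z0 \<noteq> 0" using assms by blast
  then have "\<forall>\<^sub>F w in at z. g w \<noteq> 0 \<and> w \<in> UNIV"
    by (intro non_zero_neighbour_alt[OF assms(1)]) auto
  then show ?thesis by (intro eventually_frequently) (auto elim: eventually_mono)
qed

lemma zero_count_ge:
  assumes "finite F" "F \<subseteq> A" "\<And>z. z \<in> F \<Longrightarrow> enat (g z) \<le> zero_mult f z"
  shows "enat (sum g F) \<le> zero_count f A"
proof (cases "finite {z \<in> A. zero_mult f z \<noteq> 0}")
  case True
  have "enat (sum g F) = (\<Sum>z\<in>F. enat (g z))"
    using assms(1) by induction (auto simp: zero_enat_def simp flip: plus_enat_simps(1))
  also have "\<dots> \<le> (\<Sum>z\<in>F. zero_mult f z)"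
    by (intro sum_mono assms)
  also have "\<dots> = (\<Sum>z\<in>F \<inter> {z \<in> A. zero_mult f z \<noteq> 0}. zero_mult f z)"
    using assms by (intro sum.mono_neutral_right) auto
  also have "\<dots> \<le> (\<Sum>z\<in>{z \<in> A. zero_mult f z \<noteq> 0}. zero_mult f z)"
    by (intro sum_mono2 True) auto
  finally show ?thesis using True by (simp add: zero_count_def)
qed (auto simp: zero_count_def)

lemma zero_mult_entire:
  assumes "g holomorphic_on UNIV" "\<exists>z. g z \<noteq> 0"
  shows "zero_mult g z = enat (nat (zorder g z))"
  using entire_frequently_nonzero[OF assms, of z] by (auto simp: zero_mult_def frequently_def)

lemma zero_mult_pos_iff_entire:
  assumes "g holomorphic_on UNIV" "\<exists>z. g z \<noteq> 0"
  shows "zero_mult g z \<noteq> 0 \<longleftrightarrow> g z = 0"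
  unfolding zero_mult_entire[OF assms]
  using zorder_pos_iff[OF assms(1) _ _ entire_frequently_nonzero[OF assms], of z]
  by (auto simp: zero_enat_def)

lemma one_le_zero_mult:
  assumes "g analytic_on {z}" "g z = 0"
  shows "1 \<le> zero_mult g z"
proof (cases "\<forall>\<^sub>F w in at z. g w = 0")
  case False
  then have "zorder g z > 0"
    using zorder_pos_iff'[OF assms(1)] assms(2) by (simp add: frequently_def)
  then show ?thesis using False by (simp add: zero_mult_def one_enat_def)
qed (simp add: zero_mult_def)

lemma zero_mult_deriv_ge:
  assumes "g meromorphic_on {z}" "\<exists>\<^sub>F w in at z. g w \<noteq> 0" "zorder g z > 0"
  shows "enat (nat (zorder g z - 1)) \<le> zero_mult (deriv g) z"
proof -
  have "zorder (deriv g) z = zorder g z - 1"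
    using assms by (intro zorder_deriv_minus_1) (auto simp: meromorphic_at_iff)
  then show ?thesis by (simp add: zero_mult_def)
qed

section \<open>The divisor of the quotient\<close>

lemma zero_count_finite_imp_nonzero:
  assumes "zero_count g (- \<real>) = enat M"
  shows "\<exists>z. g z \<noteq> 0"
proof (rule ccontr)
  assume "\<not> ?thesis"
  then have "zero_mult g z = \<infinity>" for z
    by (simp add: zero_mult_def)
  then have "enat (\<Sum>z\<in>{\<i>}. Suc M) \<le> zero_count g (- \<real>)"
    by (intro zero_count_ge) (auto simp: complex_is_Real_iff)
  then show False using assms by simp
qed

text \<open>
  Let \<open>A\<close> be the set of real zeros of \<open>\<phi>\<close> and \<open>Z\<close> the set of real zeros of its
  derivative outside \<open>A\<close>. The quotient has simple poles on \<open>A\<close> and zeros on \<open>Z\<close>. The set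
  \<open>B\<close> picks from \<open>Z\<close> the points with no predecessor in the same component of the complement
  of \<open>A\<close>: two points of \<open>B\<close> are then separated by \<open>A\<close>, and Rolle's theorem for \<open>\<phi>\<close>
  places a point of \<open>B\<close> between any two points of \<open>A\<close>, so \<open>A \<union> B\<close> alternates. What
  is left of the divisor is paid for by zeros of the derivative \<open>Q\<close> of the logarithmic derivative
  \<open>L\<close>: a zero of \<open>L\<close> of order \<open>k\<close> is a zero of \<open>Q\<close> of order \<open>k - 1\<close>, and each
  point of \<open>Z - B\<close> has, by Rolle's theorem for \<open>L\<close>, its own zero of \<open>Q\<close> just to the
  left of it.
\<close>

theorem divisor_of_deriv_quotient:
  fixes p f \<phi> :: "complex \<Rightarrow> complex"
  assumes \<phi>: "\<And>z. \<phi> z = p z * f z"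
    and p: "p holomorphic_on UNIV" "\<And>x::real. p (of_real x) \<noteq> 0"
    and f: "f holomorphic_on UNIV" "\<And>z. Im z \<noteq> 0 \<Longrightarrow> f z \<noteq> 0"
    and real: "\<And>x::real. \<phi> (of_real x) \<in> \<real>"
    and nonreal: "zero_count (deriv \<phi>) (- \<real>) = enat M"
    and finQ: "zero_count (deriv (\<lambda>z. deriv \<phi> z / \<phi> z)) \<real> = enat n"
  shows "\<exists>(X :: real set) \<sigma> (E :: complex set) (e :: complex \<Rightarrow> nat).
    alternating X \<sigma> \<and> (\<forall>R. finite (X \<inter> {-R..R})) \<and> finite E \<and> sum e E \<le> n + M \<and>
    (\<forall>z. zorder (\<lambda>z. deriv \<phi> z / f z) z =
        (if z \<in> of_real ` X then \<sigma> (Re z) else 0) + (if z \<in> E then int (e z) else 0))"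
proof -
  have \<phi>_holo: "\<phi> holomorphic_on UNIV"
    using p(1) f(1) by (simp add: \<phi>[abs_def] holomorphic_intros)
  have d_holo: "deriv \<phi> holomorphic_on UNIV"
    by (intro holomorphic_deriv \<phi>_holo) auto
  have ana: "g analytic_on {z}" if "g holomorphic_on UNIV" for g :: "complex \<Rightarrow> complex" and z
    using that by (auto intro: holomorphic_on_imp_analytic_at)
  have fd: "g field_differentiable at z" if "g holomorphic_on UNIV" for g :: "complex \<Rightarrow> complex" and z
    using that by (simp add: holomorphic_on_def)
  have d_nz: "\<exists>z. deriv \<phi> z \<noteq> 0"
    by (rule zero_count_finite_imp_nonzero[OF nonreal])
  have f_nz: "\<exists>z. f z \<noteq> 0" using f(2)[of \<i>] by auto
  have \<phi>_nz: "\<exists>z. \<phi> z \<noteq> 0"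
  proof (rule ccontr)
    assume "\<not> ?thesis"
    then have "\<phi> = (\<lambda>z. 0)" by auto
    then show False using d_nz by simp
  qed
  have p_nz: "\<exists>z. p z \<noteq> 0" using \<phi>_nz by (auto simp: \<phi>)
  note freq = entire_frequently_nonzero
  define L where "L = (\<lambda>z. deriv \<phi> z / \<phi> z)"
  have d_real: "deriv \<phi> (of_real x) \<in> \<real>" for x
    by (rule deriv_real_on_reals[OF fd[OF \<phi>_holo] real])
  have L_real: "L (of_real x) \<in> \<real>" for x
    using d_real real by (simp add: L_def Reals_divide)
  have L_ana: "L analytic_on {z}" if "\<phi> z \<noteq> 0" for z
    unfolding L_def using that by (intro analytic_intros ana d_holo \<phi>_holo) auto
  define A where "A = {x::real. \<phi> (of_real x) = 0}"
  define Z where "Z = {x::real. \<phi> (of_real x) \<noteq> 0 \<and> deriv \<phi> (of_real x) = 0}"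
  define B where "B = {x \<in> Z. \<forall>w\<in>Z. w < x \<longrightarrow> (\<exists>a\<in>A. w \<le> a \<and> a \<le> x)}"
  define \<sigma> :: "real \<Rightarrow> int" where "\<sigma> = (\<lambda>x. if x \<in> B then 1 else - 1)"
  have finA: "finite (A \<inter> {a..b})" for a b
    using entire_finite_zeros_Icc[OF \<phi>_holo \<phi>_nz, of a b]
    by (rule finite_subset[rotated]) (auto simp: A_def)
  have finZ: "finite (Z \<inter> {a..b})" for a b
    using entire_finite_zeros_Icc[OF d_holo d_nz, of a b]
    by (rule finite_subset[rotated]) (auto simp: Z_def)
  have AZ: "A \<inter> Z = {}" and BZ: "B \<subseteq> Z" by (auto simp: A_def Z_def B_def)
  have between: "\<exists>b\<in>B. a < b \<and> b < a'" if "a \<in> A" "a' \<in> A" "a < a'" for a a'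
  proof -
    \<comment> \<open>\<open>c\<close> is the zero of \<open>\<phi>\<close> next to \<open>a\<close>; the first point of \<open>Z\<close> in between is in \<open>B\<close>.\<close>
    define c where "c = Min (A \<inter> {a<..a'})"
    have fin: "finite (A \<inter> {a<..a'})"
      using finA[of a a'] by (rule finite_subset[rotated]) auto
    have ne: "A \<inter> {a<..a'} \<noteq> {}" using that by auto
    have c: "c \<in> A" "a < c" "c \<le> a'" using Min_in[OF fin ne] by (auto simp: c_def)
    have c_min: "x \<notin> A" if "a < x" "x < c" for x
      using Min_le[OF fin, of x] that c by (force simp: c_def)
    obtain t where t: "a < t" "t < c" "deriv \<phi> (of_real t) = 0"
      using Rolle_real_on_reals[OF c(2) fd[OF \<phi>_holo] real] c \<open>a \<in> A\<close> by (auto simp: A_def)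
    define b where "b = Min (Z \<inter> {a..t})"
    have "t \<in> Z" using t c_min by (auto simp: Z_def A_def)
    then have ne: "Z \<inter> {a..t} \<noteq> {}" using t by auto
    have b: "b \<in> Z" "a \<le> b" "b \<le> t" using Min_in[OF finZ ne] by (auto simp: b_def)
    have "\<exists>x\<in>A. w \<le> x \<and> x \<le> b" if w: "w \<in> Z" "w < b" for w
    proof (cases "w < a")
      case True
      then show ?thesis using \<open>a \<in> A\<close> b by (intro bexI[of _ a]) auto
    next
      case False
      then have "b \<le> w" unfolding b_def by (intro Min_le[OF finZ]) (use w b in auto)
      then show ?thesis using w by simp
    qed
    then have "b \<in> B" using b by (auto simp: B_def)
    moreover have "a \<noteq> b" using b \<open>a \<in> A\<close> AZ by auto
    ultimately show ?thesis using b t c by (intro bexI[of _ b]) auto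
  qed
  have alt: "alternating (A \<union> B) \<sigma>"
    unfolding alternating_def
  proof (intro conjI ballI impI)
    fix x y assume xy: "x \<in> A \<union> B" "y \<in> A \<union> B" "x < y \<and> \<sigma> x = \<sigma> y"
    show "\<exists>w\<in>A \<union> B. x < w \<and> w < y \<and> \<sigma> w \<noteq> \<sigma> x"
    proof (cases "x \<in> B")
      case True
      then have y: "y \<in> B" using xy by (auto simp: \<sigma>_def split: if_splits)
      then obtain a where a: "a \<in> A" "x \<le> a" "a \<le> y"
        using xy True BZ by (auto simp: B_def)
      moreover have "a \<noteq> x" "a \<noteq> y" "a \<notin> B" using a True y AZ BZ by auto
      ultimately show ?thesis using True by (intro bexI[of _ a]) (auto simp: \<sigma>_def)
    next
      case False
      then have "x \<in> A" "y \<in> A" using xy by (auto simp: \<sigma>_def split: if_splits)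
      then obtain b where "b \<in> B" "x < b" "b < y" using between xy by blast
      then show ?thesis using False by (intro bexI[of _ b]) (auto simp: \<sigma>_def)
    qed
  qed (auto simp: \<sigma>_def)
  have finX: "finite ((A \<union> B) \<inter> {-R..R})" for R
    by (rule finite_subset[OF _ finite_UnI[OF finA[of "-R" R] finZ[of "-R" R]]]) (use BZ in auto)
  \<comment> \<open>Rolle's theorem for \<open>L\<close> between \<open>x\<close> and its predecessor in \<open>Z\<close>. The last condition
    makes the choice of \<open>t\<close> injective in \<open>x\<close>.\<close>
  have "\<exists>t<x. deriv L (of_real t) = 0 \<and> t \<notin> A \<and> t \<notin> Z \<and> (\<forall>w\<in>Z. w < x \<longrightarrow> w < t)"
    if x: "x \<in> Z - B" for x
  proof -
    obtain w where w: "w \<in> Z" "w < x" "\<And>a. a \<in> A \<Longrightarrow> w \<le> a \<Longrightarrow> a \<le> x \<Longrightarrow> False"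
      using x by (auto simp: B_def)
    define v where "v = Max (Z \<inter> {w..<x})"
    have fin: "finite (Z \<inter> {w..<x})"
      using finZ[of w x] by (rule finite_subset[rotated]) auto
    have ne: "Z \<inter> {w..<x} \<noteq> {}" using w by auto
    have v: "v \<in> Z" "w \<le> v" "v < x" using Max_in[OF fin ne] by (auto simp: v_def)
    have v_max: "u \<le> v" if "u \<in> Z" "u < x" for u
    proof (cases "w \<le> u")
      case True
      then show ?thesis using that Max_ge[OF fin, of u] by (auto simp: v_def)
    qed (use v in auto)
    have "\<exists>t. v < t \<and> t < x \<and> deriv L (of_real t) = 0"
    proof (rule Rolle_real_on_reals[where g = L])
      fix t assume "v \<le> t" "t \<le> x"
      then have "t \<notin> A" using w(3)[of t] v by auto
      then show "L field_differentiable at (of_real t)"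
        by (intro analytic_on_imp_differentiable_at[OF L_ana]) (auto simp: A_def)
    next
      show "L (of_real t) \<in> \<real>" for t by (rule L_real)
    qed (use v x in \<open>auto simp: L_def Z_def\<close>)
    then obtain t where t: "v < t" "t < x" "deriv L (of_real t) = 0" by blast
    show ?thesis
    proof (intro exI[of _ t] conjI ballI impI)
      show "t \<notin> A" using t v w(3)[of t] by auto
      show "t \<notin> Z" using t v_max[of t] by auto
      show "u < t" if "u \<in> Z" "u < x" for u using v_max[OF that] t by simp
    qed (use t in auto)
  qed
  then obtain T where T: "\<And>x. x \<in> Z - B \<Longrightarrow> T x < x \<and> deriv L (of_real (T x)) = 0 \<and>
      T x \<notin> A \<and> T x \<notin> Z \<and> (\<forall>w\<in>Z. w < x \<longrightarrow> w < T x)"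
    by metis
  have inj_T: "inj_on T (Z - B)"
  proof (rule linorder_inj_onI)
    fix x y assume "x < y" "x \<in> Z - B" "y \<in> Z - B"
    then show "T x \<noteq> T y" using T[of x] T[of y] by force
  qed auto
  define k where "k = (\<lambda>x::real. zorder (deriv \<phi>) (of_real x))"
  have k_pos: "k x \<ge> 1" if "x \<in> Z" for x
    using zorder_pos_iff[OF d_holo _ _ freq[OF d_holo d_nz], of "of_real x"] that
    by (simp add: k_def Z_def)
  \<comment> \<open>The multiple zeros of \<open>L\<close>, which are themselves zeros of its derivative.\<close>
  define S where "S = {x \<in> Z. k x \<ge> 2}"
  have mult_S: "enat (nat (k x - 1)) \<le> zero_mult (deriv L) (of_real x)" if "x \<in> Z" for x
  proof -
    have "zorder L (of_real x) = k x - zorder \<phi> (of_real x)"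
      unfolding L_def k_def
      by (intro zorder_divide freq analytic_on_imp_meromorphic_on ana d_holo \<phi>_holo d_nz \<phi>_nz)
    also have "zorder \<phi> (of_real x) = 0"
      using that by (intro zorder_eq_0I ana \<phi>_holo) (auto simp: Z_def)
    finally have zL: "zorder L (of_real x) = k x" by simp
    have "\<exists>\<^sub>F w in at (of_real x). L w \<noteq> 0"
    proof -
      have "\<forall>\<^sub>F w in at (of_real x). deriv \<phi> w \<noteq> 0" "\<forall>\<^sub>F w in at (of_real x). \<phi> w \<noteq> 0"
        by (intro non_zero_neighbour freq isolated_singularity_at_analytic not_essential_analytic ana d_holo \<phi>_holo d_nz \<phi>_nz)+
      then have "\<forall>\<^sub>F w in at (of_real x). L w \<noteq> 0"
        by eventually_elim (simp add: L_def)
      then show ?thesis by (intro eventually_frequently) auto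
    qed
    then show ?thesis
      using zero_mult_deriv_ge[of L "of_real x"] L_ana[of "of_real x"] that zL k_pos[OF that]
      by (auto simp: Z_def intro: analytic_on_imp_meromorphic_on)
  qed
  have mult_T: "1 \<le> zero_mult (deriv L) (of_real (T x))" if "x \<in> Z - B" for x
    using T[OF that] by (intro one_le_zero_mult analytic_deriv L_ana) (auto simp: A_def)
  have finZQ: "finite {z \<in> \<real>. zero_mult (deriv L) z \<noteq> 0}"
    using finQ by (auto simp: zero_count_def L_def split: if_splits)
  have finS: "finite S"
  proof -
    have "of_real ` S \<subseteq> {z \<in> \<real>. zero_mult (deriv L) z \<noteq> 0}"
    proof safe
      fix x assume x: "x \<in> S" "zero_mult (deriv L) (of_real x) = 0"
      then show False using mult_S[of x] by (auto simp: S_def zero_enat_def)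
    qed auto
    then show ?thesis
      using finZQ finite_subset finite_imageD[OF _ inj_on_subset[OF inj_of_real subset_UNIV]] by metis
  qed
  have finT: "finite (Z - B)"
  proof -
    have "(\<lambda>x. complex_of_real (T x)) ` (Z - B) \<subseteq> {z \<in> \<real>. zero_mult (deriv L) z \<noteq> 0}"
      using mult_T by fastforce
    then have "finite ((\<lambda>x. complex_of_real (T x)) ` (Z - B))"
      using finZQ finite_subset by blast
    then show ?thesis
      by (rule finite_imageD) (use inj_T in \<open>auto simp: inj_on_def\<close>)
  qed
  \<comment> \<open>The part of the divisor on the real axis that the alternating set does not account for.\<close>
  define er where "er = (\<lambda>x. nat (k x - (if x \<in> B then 1 else 0)))"
  define Er where "Er = S \<union> (Z - B)"
  have finEr: "finite Er" using finS finT by (simp add: Er_def)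
  have sum_er: "sum er Er \<le> n"
  proof -
    define g where "g = (\<lambda>z. if Re z \<in> S then nat (k (Re z) - 1) else 1)"
    define F where "F = complex_of_real ` (S \<union> T ` (Z - B))"
    have disj: "S \<inter> T ` (Z - B) = {}" using T by (auto simp: S_def)
    have "enat (sum g F) \<le> zero_count (deriv L) \<real>"
    proof (rule zero_count_ge)
      show "enat (g z) \<le> zero_mult (deriv L) z" if "z \<in> F" for z
        using that mult_S mult_T disj by (auto simp: F_def g_def S_def one_enat_def)
    qed (use finS finT in \<open>auto simp: F_def\<close>)
    then have "sum g F \<le> n" using finQ by (simp add: L_def)
    moreover have "sum g F = (\<Sum>x\<in>S. nat (k x - 1)) + card (Z - B)"
    proof -
      have "sum g F = (\<Sum>x\<in>S \<union> T ` (Z - B). g (of_real x))"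
        unfolding F_def by (subst sum.reindex) (auto simp: inj_on_def)
      also have "\<dots> = (\<Sum>x\<in>S. g (of_real x)) + (\<Sum>x\<in>T ` (Z - B). g (of_real x))"
        using finS finT disj by (intro sum.union_disjoint) auto
      also have "(\<Sum>x\<in>S. g (of_real x)) = (\<Sum>x\<in>S. nat (k x - 1))"
        by (intro sum.cong) (auto simp: g_def)
      also have "(\<Sum>x\<in>T ` (Z - B). g (of_real x)) = (\<Sum>x\<in>T ` (Z - B). 1)"
        using disj by (intro sum.cong) (auto simp: g_def)
      also have "\<dots> = card (Z - B)"
        using card_image[OF inj_T] by simp
      finally show ?thesis .
    qed
    moreover have "sum er Er = (\<Sum>x\<in>Er. nat (k x - 1)) + (\<Sum>x\<in>Er. if x \<in> Z - B then 1 else 0)"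
      unfolding sum.distrib[symmetric]
    proof (rule sum.cong)
      fix x assume "x \<in> Er"
      then have x: "x \<in> Z" by (auto simp: Er_def S_def)
      then have "nat (k x) = nat (k x - 1) + 1" using k_pos[OF x] by arith
      then show "er x = nat (k x - 1) + (if x \<in> Z - B then 1 else 0)"
        using x by (simp add: er_def)
    qed simp
    moreover have "(\<Sum>x\<in>Er. nat (k x - 1)) = (\<Sum>x\<in>S. nat (k x - 1))"
      using finEr by (intro sum.mono_neutral_right) (auto simp: Er_def S_def)
    moreover have "(\<Sum>x\<in>Er. if x \<in> Z - B then 1 else 0) = card (Z - B)"
    proof -
      have "(\<Sum>x\<in>Er. if x \<in> Z - B then 1 else 0) = (\<Sum>x\<in>Er \<inter> (Z - B). 1::nat)"
        using finEr by (simp only: sum.inter_restrict)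
      also have "Er \<inter> (Z - B) = Z - B" by (auto simp: Er_def)
      finally show ?thesis by simp
    qed
    ultimately show ?thesis by simp
  qed
  define C where "C = {z. z \<notin> \<real> \<and> deriv \<phi> z = 0}"
  have C_eq: "{z \<in> - \<real>. zero_mult (deriv \<phi>) z \<noteq> 0} = C"
    using zero_mult_pos_iff_entire[OF d_holo d_nz] by (auto simp: C_def)
  have finC: "finite C" and sumC: "(\<Sum>z\<in>C. nat (zorder (deriv \<phi>) z)) = M"
  proof -
    have *: "finite C \<and> (\<Sum>z\<in>C. zero_mult (deriv \<phi>) z) = enat M"
      using nonreal unfolding zero_count_def C_eq by (auto split: if_splits)
    then show "finite C" by simp
    then have "enat (\<Sum>z\<in>C. nat (zorder (deriv \<phi>) z)) = (\<Sum>z\<in>C. enat (nat (zorder (deriv \<phi>) z)))"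
      by induction (auto simp: zero_enat_def simp flip: plus_enat_simps(1))
    then show "(\<Sum>z\<in>C. nat (zorder (deriv \<phi>) z)) = M"
      using * by (simp add: zero_mult_entire[OF d_holo d_nz])
  qed
  define e where "e = (\<lambda>z. if z \<in> \<real> then er (Re z) else nat (zorder (deriv \<phi>) z))"
  define E where "E = C \<union> of_real ` Er"
  have finE: "finite E" using finC finEr by (simp add: E_def)
  have "sum e E = (\<Sum>z\<in>C. e z) + (\<Sum>z\<in>of_real ` Er. e z)"
    unfolding E_def using finC finEr by (intro sum.union_disjoint) (auto simp: C_def)
  also have "(\<Sum>z\<in>C. e z) = M"
    unfolding sumC[symmetric] by (intro sum.cong) (auto simp: e_def C_def)
  also have "(\<Sum>z\<in>of_real ` Er. e z) = sum er Er"
    by (subst sum.reindex) (auto simp: inj_on_def e_def)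
  finally have sumE: "sum e E \<le> n + M" using sum_er by simp
  have zorder: "zorder (\<lambda>z. deriv \<phi> z / f z) z =
        (if z \<in> of_real ` (A \<union> B) then \<sigma> (Re z) else 0) + (if z \<in> E then int (e z) else 0)" for z
  proof -
    have zN: "zorder (\<lambda>z. deriv \<phi> z / f z) z = zorder (deriv \<phi>) z - zorder f z"
      by (intro zorder_divide freq analytic_on_imp_meromorphic_on ana d_holo f(1) d_nz f_nz)
    have d_nonneg: "zorder (deriv \<phi>) z \<ge> 0"
      by (intro zorder_ge_0 ana d_holo freq d_nz)
    show ?thesis
    proof (cases "z \<in> \<real>")
      case False
      then have "f z \<noteq> 0" using f(2)[of z] complex_is_Real_iff[of z] by blast
      then have "zorder f z = 0" by (intro zorder_eq_0I ana f(1))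
      moreover have "z \<notin> of_real ` Y" for Y using False by auto
      moreover have "zorder (deriv \<phi>) z = 0" if "z \<notin> C"
        using that False by (intro zorder_eq_0I ana d_holo) (auto simp: C_def)
      ultimately show ?thesis
        using zN d_nonneg False by (auto simp: E_def e_def)
    next
      case True
      then obtain x where x: "z = of_real x" by (auto simp: Reals_def)
      have zx: "Re z = x" "z \<in> \<real>" by (simp_all add: x)
      have mem: "z \<in> of_real ` Y \<longleftrightarrow> x \<in> Y" for Y by (auto simp: x)
      have memE: "z \<in> E \<longleftrightarrow> x \<in> Er" using mem[of Er] by (auto simp: E_def C_def x)
      show ?thesis
      proof (cases "x \<in> A")
        case True
        have "zorder \<phi> z = zorder p z + zorder f z"
          unfolding \<phi>[abs_def]
          by (intro zorder_mult freq analytic_on_imp_meromorphic_on ana p(1) f(1) p_nz f_nz)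
        moreover have "zorder p z = 0"
          by (intro zorder_eq_0I ana p(1)) (use p x in auto)
        moreover have "zorder \<phi> z > 0"
          using zorder_pos_iff[OF \<phi>_holo _ _ freq[OF \<phi>_holo \<phi>_nz], of z] True by (simp add: A_def x)
        moreover from this have "zorder (deriv \<phi>) z = zorder \<phi> z - 1"
          by (intro zorder_deriv_minus_1 isolated_singularity_at_analytic not_essential_analytic ana \<phi>_holo freq \<phi>_nz) auto
        moreover have "x \<notin> B" "x \<notin> Er" using True AZ BZ by (auto simp: Er_def S_def)
        ultimately show ?thesis using zN True by (simp add: mem memE \<sigma>_def zx)
      next
        case False
        then have "f z \<noteq> 0" by (auto simp: A_def x \<phi>)
        then have "zorder f z = 0" by (intro zorder_eq_0I ana f(1))
        then have zN: "zorder (\<lambda>z. deriv \<phi> z / f z) z = k x" using zN by (simp add: k_def x)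
        show ?thesis
        proof (cases "x \<in> Z")
          case True
          have "x \<in> B \<and> k x = 1" if "x \<notin> Er"
            using that True k_pos[OF True] by (auto simp: Er_def S_def)
          then show ?thesis
            using zN False True k_pos[OF True] by (auto simp: mem memE \<sigma>_def e_def er_def zx)
        next
          case no: False
          then have "k x = 0"
            unfolding k_def using False by (intro zorder_eq_0I ana d_holo) (auto simp: Z_def A_def)
          moreover have "x \<notin> B" "x \<notin> Er" using no BZ by (auto simp: Er_def S_def)
          ultimately show ?thesis using zN False by (simp add: mem memE)
        qed
      qed
    qed
  qed
  show ?thesis
    by (intro exI[of _ "A \<union> B"] exI[of _ \<sigma>] exI[of _ E] exI[of _ e] conjI allI alt finX finE sumE zorder)
qed

section \<open>Weierstrass products over real zeros\<close>

text \<open>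
  The zeros enter through their reciprocals \<open>\<beta> j\<close>, so that \<open>\<beta> j = 0\<close> stands for a factor
  that is absent.
\<close>

definition wprod :: "nat \<Rightarrow> (nat \<Rightarrow> real) \<Rightarrow> complex \<Rightarrow> complex" where
  "wprod l \<beta> z = (\<Prod>j. weierstrass_factor l (z * of_real (\<beta> j)))"

context
  fixes l :: nat and \<beta> :: "nat \<Rightarrow> real"
  assumes summable_\<beta>: "summable (\<lambda>j. \<bar>\<beta> j\<bar> ^ (l + 1))"
begin

lemma eventually_small:
  assumes "R > 0"
  shows "\<forall>\<^sub>F j in sequentially. R * \<bar>\<beta> j\<bar> < 1 / 2"
proof -
  have "(\<lambda>j. \<bar>\<beta> j\<bar> ^ (l + 1)) \<longlonglongrightarrow> 0"
    by (rule summable_LIMSEQ_zero[OF summable_\<beta>])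
  then have "\<forall>\<^sub>F j in sequentially. \<bar>\<beta> j\<bar> ^ (l + 1) < (1 / (2 * R)) ^ (l + 1)"
    by (rule order_tendstoD) (use assms in auto)
  then show ?thesis
  proof eventually_elim
    case (elim j)
    then have "\<bar>\<beta> j\<bar> < 1 / (2 * R)"
      by (rule power_less_imp_less_base) (use assms in auto)
    then show ?case using assms by (simp add: field_simps)
  qed
qed

lemma weierstrass_factor_bound_cball:
  assumes "R > 0"
  shows "\<forall>\<^sub>F j in sequentially. \<forall>z\<in>cball 0 R.
    norm (weierstrass_factor l (z * of_real (\<beta> j)) - 1) \<le> 3 * R ^ (l + 1) * \<bar>\<beta> j\<bar> ^ (l + 1)"
  using eventually_small[OF assms]
proof eventually_elim
  case (elim j)
  show ?case
  proof
    fix z :: complex assume z: "z \<in> cball 0 R"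
    have le: "norm (z * of_real (\<beta> j)) \<le> R * \<bar>\<beta> j\<bar>"
      using z by (simp add: norm_mult mult_right_mono)
    have "norm (weierstrass_factor l (z * of_real (\<beta> j)) - 1) \<le> 3 * norm (z * of_real (\<beta> j)) ^ Suc l"
      by (rule weierstrass_factor_bound) (use le elim in linarith)
    also have "\<dots> \<le> 3 * (R * \<bar>\<beta> j\<bar>) ^ Suc l"
      using le by (intro mult_left_mono power_mono) auto
    finally show "norm (weierstrass_factor l (z * of_real (\<beta> j)) - 1) \<le> 3 * R ^ (l + 1) * \<bar>\<beta> j\<bar> ^ (l + 1)"
      by (simp add: power_mult_distrib mult_ac)
  qed
qed

lemma wprod_convergent: "convergent_prod (\<lambda>j. weierstrass_factor l (z * of_real (\<beta> j)))"
proof -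
  have R: "norm z + 1 > 0" by (simp add: add_nonneg_pos)
  have "abs_convergent_prod (\<lambda>j. weierstrass_factor l (z * of_real (\<beta> j)))"
    unfolding abs_convergent_prod_conv_summable
  proof (rule summable_comparison_test_ev)
    show "summable (\<lambda>j. 3 * (norm z + 1) ^ (l + 1) * \<bar>\<beta> j\<bar> ^ (l + 1))"
      by (intro summable_mult summable_\<beta>)
    show "\<forall>\<^sub>F j in sequentially. norm (norm (weierstrass_factor l (z * of_real (\<beta> j)) - 1))
        \<le> 3 * (norm z + 1) ^ (l + 1) * \<bar>\<beta> j\<bar> ^ (l + 1)"
      using weierstrass_factor_bound_cball[OF R] by eventually_elim simp
  qed
  then show ?thesis by (rule abs_convergent_prod_imp_convergent_prod)
qed

lemma wprod_LIMSEQ: "(\<lambda>n. \<Prod>j<n. weierstrass_factor l (z * of_real (\<beta> j))) \<longlonglongrightarrow> wprod l \<beta> z"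
proof -
  have "(\<lambda>n. \<Prod>j<Suc n. weierstrass_factor l (z * of_real (\<beta> j))) \<longlonglongrightarrow> wprod l \<beta> z"
    using convergent_prod_LIMSEQ[OF wprod_convergent[of z]]
    unfolding lessThan_Suc_atMost by (simp add: wprod_def)
  then show ?thesis by (rule LIMSEQ_imp_Suc)
qed

lemma wprod_uniform_limit:
  assumes "R > 0"
  shows "uniform_limit (cball 0 R) (\<lambda>n z. \<Prod>j<n. weierstrass_factor l (z * of_real (\<beta> j))) (wprod l \<beta>) sequentially"
proof -
  have "uniformly_convergent_on (cball 0 R) (\<lambda>n z. \<Prod>j<n. weierstrass_factor l (z * of_real (\<beta> j)))"
  proof (rule uniformly_convergent_on_prod')
    show "uniformly_convergent_on (cball 0 R) (\<lambda>n z. \<Sum>j<n. norm (weierstrass_factor l (z * of_real (\<beta> j)) - 1))"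
    proof (rule Weierstrass_m_test'_ev)
      show "\<forall>\<^sub>F j in sequentially. \<forall>z\<in>cball 0 R. norm (norm (weierstrass_factor l (z * of_real (\<beta> j)) - 1))
          \<le> 3 * R ^ (l + 1) * \<bar>\<beta> j\<bar> ^ (l + 1)"
        using weierstrass_factor_bound_cball[OF assms] by simp
      show "summable (\<lambda>j. 3 * R ^ (l + 1) * \<bar>\<beta> j\<bar> ^ (l + 1))"
        by (intro summable_mult summable_\<beta>)
    qed
  qed (auto intro!: continuous_intros)
  then obtain g where g: "uniform_limit (cball 0 R) (\<lambda>n z. \<Prod>j<n. weierstrass_factor l (z * of_real (\<beta> j))) g sequentially"
    by (auto simp: uniformly_convergent_on_def)
  have "g z = wprod l \<beta> z" if "z \<in> cball 0 R" for z
    using tendsto_uniform_limitI[OF g that] wprod_LIMSEQ LIMSEQ_unique by blast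
  then have "uniform_limit (cball 0 R) (\<lambda>n z. \<Prod>j<n. weierstrass_factor l (z * of_real (\<beta> j))) g sequentially \<longleftrightarrow>
    uniform_limit (cball 0 R) (\<lambda>n z. \<Prod>j<n. weierstrass_factor l (z * of_real (\<beta> j))) (wprod l \<beta>) sequentially"
    by (intro uniform_limit_cong) auto
  then show ?thesis using g by simp
qed

lemma wprod_holomorphic: "wprod l \<beta> holomorphic_on UNIV"
proof (rule holomorphic_uniform_sequence)
  fix z :: complex
  have "uniform_limit (cball 0 (norm z + 1)) (\<lambda>n z. \<Prod>j<n. weierstrass_factor l (z * of_real (\<beta> j))) (wprod l \<beta>) sequentially"
    by (rule wprod_uniform_limit) (auto intro: add_nonneg_pos)
  then have "uniform_limit (cball z 1) (\<lambda>n z. \<Prod>j<n. weierstrass_factor l (z * of_real (\<beta> j))) (wprod l \<beta>) sequentially"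
    by (rule uniform_limit_on_subset) (simp add: cball_subset_cball_iff)
  then show "\<exists>d>0. cball z d \<subseteq> UNIV \<and> uniform_limit (cball z d)
      (\<lambda>n z. \<Prod>j<n. weierstrass_factor l (z * of_real (\<beta> j))) (wprod l \<beta>) sequentially"
    by (intro exI[of _ 1]) auto
qed (auto intro!: holomorphic_intros)

lemma wprod_nonzero:
  assumes "Im z \<noteq> 0"
  shows "wprod l \<beta> z \<noteq> 0"
proof
  assume "wprod l \<beta> z = 0"
  moreover have "(\<lambda>j. weierstrass_factor l (z * of_real (\<beta> j))) has_prod wprod l \<beta> z"
    using wprod_convergent convergent_prod_has_prod by (auto simp: wprod_def)
  ultimately obtain j where "z * of_real (\<beta> j) = 1"
    using has_prod_eq_0_iff by fastforce
  then have "Im (z * of_real (\<beta> j)) = 0" "\<beta> j \<noteq> 0" by auto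
  then show False using assms by simp
qed

lemma wprod_real: "wprod l \<beta> (of_real x) \<in> \<real>"
proof (rule Lim_in_closed_set[OF _ _ _ wprod_LIMSEQ])
  have "weierstrass_factor l (of_real x * of_real (\<beta> j)) \<in> \<real>" for j
    unfolding weierstrass_factor_def
    by (intro Reals_mult Reals_diff exp_in_Reals sum_in_Reals Reals_divide Reals_power) auto
  then show "\<forall>\<^sub>F n in sequentially. (\<Prod>j<n. weierstrass_factor l (of_real x * of_real (\<beta> j))) \<in> \<real>"
    by (intro always_eventually allI prod_in_Reals) auto
qed (auto simp: closed_complex_Reals)

lemma logderiv_weierstrass_factor:
  assumes "z * of_real b \<noteq> 1"
  shows "deriv (\<lambda>z. weierstrass_factor l (z * of_real b)) z / weierstrass_factor l (z * of_real b)
       = z ^ l * of_real b ^ (l + 1) / (z * of_real b - 1)"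
proof -
  define u where "u = z * of_real b"
  define S where "S = (\<Sum>k=1..l. u ^ k / of_nat k)"
  have D_sum: "((\<lambda>z. \<Sum>k=1..l. (z * of_real b) ^ k / of_nat k) has_field_derivative
      (\<Sum>k=1..l. u ^ (k - 1) * of_real b)) (at z)"
  proof (rule DERIV_sum)
    fix k assume k: "k \<in> {1..l}"
    have "((\<lambda>z. (z * of_real b) ^ k / of_nat k) has_field_derivative
        of_nat k * ((1 * of_real b) * (z * of_real b) ^ (k - Suc 0)) / of_nat k) (at z)"
      by (intro DERIV_cdivide DERIV_power DERIV_cmult_right DERIV_ident)
    then show "((\<lambda>z. (z * of_real b) ^ k / of_nat k) has_field_derivative u ^ (k - 1) * of_real b) (at z)"
      using k by (simp add: u_def mult.commute)
  qed
  have D: "((\<lambda>z. weierstrass_factor l (z * of_real b)) has_field_derivative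
      (- of_real b * exp S + (1 - u) * (exp S * (\<Sum>k=1..l. u ^ (k - 1) * of_real b)))) (at z)"
  proof -
    have "((\<lambda>z. (1 - z * of_real b) * exp (\<Sum>k=1..l. (z * of_real b) ^ k / of_nat k)) has_field_derivative
        (0 - 1 * of_real b) * exp (\<Sum>k=1..l. (z * of_real b) ^ k / of_nat k) +
        exp (\<Sum>k=1..l. (z * of_real b) ^ k / of_nat k) * (\<Sum>k=1..l. u ^ (k - 1) * of_real b) * (1 - z * of_real b)) (at z)"
      by (intro DERIV_mult DERIV_diff DERIV_const DERIV_cmult_right DERIV_ident DERIV_fun_exp D_sum)
    then show ?thesis
      unfolding weierstrass_factor_def S_def u_def by (simp add: mult_ac)
  qed
  have geo: "(1 - u) * (\<Sum>k=1..l. u ^ (k - 1)) = 1 - u ^ l"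
  proof -
    have "(\<Sum>k=1..l. u ^ (k - 1)) = (\<Sum>k<l. u ^ k)"
      by (rule sum.reindex_bij_witness[of _ Suc "\<lambda>k. k - 1"]) auto
    then show ?thesis by (simp add: one_diff_power_eq)
  qed
  have "- c * E + (1 - u) * (E * (G * c)) = c * E * ((1 - u) * G - 1)" for c E G :: complex
    by (simp add: algebra_simps)
  then have "- of_real b * exp S + (1 - u) * (exp S * (\<Sum>k=1..l. u ^ (k - 1) * of_real b))
      = of_real b * exp S * ((1 - u) * (\<Sum>k=1..l. u ^ (k - 1)) - 1)"
    by (simp only: sum_distrib_right[symmetric])
  also have "\<dots> = - of_real b * exp S * u ^ l"
    unfolding geo by simp
  finally have "deriv (\<lambda>z. weierstrass_factor l (z * of_real b)) z = - of_real b * exp S * u ^ l"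
    using DERIV_imp_deriv[OF D] by simp
  moreover have "weierstrass_factor l (z * of_real b) = (1 - u) * exp S"
    by (simp add: weierstrass_factor_def u_def S_def)
  ultimately have "deriv (\<lambda>z. weierstrass_factor l (z * of_real b)) z / weierstrass_factor l (z * of_real b)
      = of_real b * u ^ l / (u - 1)"
  proof -
    have *: "- c * E * t / ((1 - u) * E) = c * t / (u - 1)" if "E \<noteq> 0" for c E t :: complex
    proof -
      have "(1 - u) * E = - ((u - 1) * E)" by (simp add: algebra_simps)
      then show ?thesis using that by simp
    qed
    assume "deriv (\<lambda>z. weierstrass_factor l (z * of_real b)) z = - of_real b * exp S * u ^ l"
      and "weierstrass_factor l (z * of_real b) = (1 - u) * exp S"
    then show ?thesis using *[of "exp S"] by simp
  qed
  then show ?thesis by (simp add: u_def power_mult_distrib mult_ac)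
qed

lemma logderiv_wprod_sums:
  assumes "Im z \<noteq> 0"
  shows "(\<lambda>j. z ^ l * of_real (\<beta> j) ^ (l + 1) / (z * of_real (\<beta> j) - 1)) sums (deriv (wprod l \<beta>) z / wprod l \<beta> z)"
proof -
  have ne: "z * of_real (\<beta> j) \<noteq> 1" for j
  proof
    assume "z * of_real (\<beta> j) = 1"
    then have "Im (z * of_real (\<beta> j)) = 0" "\<beta> j \<noteq> 0" by auto
    then show False using assms by simp
  qed
  have "(\<lambda>j. deriv (\<lambda>z. weierstrass_factor l (z * of_real (\<beta> j))) z / weierstrass_factor l (z * of_real (\<beta> j)))
      sums (deriv (wprod l \<beta>) z / wprod l \<beta> z)"
  proof (rule logderiv_prodinf_complex_uniform_limit[where A = "ball 0 (norm z + 1)"])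
    have "uniform_limit (cball 0 (norm z + 1)) (\<lambda>n z. \<Prod>j<n. weierstrass_factor l (z * of_real (\<beta> j))) (wprod l \<beta>) sequentially"
      by (rule wprod_uniform_limit) (auto intro: add_nonneg_pos)
    then show "uniform_limit (ball 0 (norm z + 1)) (\<lambda>n z. \<Prod>j<n. weierstrass_factor l (z * of_real (\<beta> j))) (wprod l \<beta>) sequentially"
      by (rule uniform_limit_on_subset) auto
  qed (use wprod_nonzero[OF assms] in \<open>auto intro!: holomorphic_intros\<close>)
  then show ?thesis by (simp only: logderiv_weierstrass_factor[OF ne])
qed

lemma norm_linear_factor_ge:
  assumes "Im z \<noteq> 0"
  shows "\<bar>Im z\<bar> / norm z \<le> norm (z * of_real b - 1)"
proof -
  have "cnj z * (z * of_real b - 1) = of_real ((norm z)\<^sup>2 * b) - cnj z"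
    by (simp only: complex_norm_square of_real_mult) (simp add: algebra_simps)
  then have "\<bar>Im z\<bar> = \<bar>Im (cnj z * (z * of_real b - 1))\<bar>"
    by simp
  also have "\<dots> \<le> norm (cnj z * (z * of_real b - 1))"
    by (rule abs_Im_le_cmod)
  also have "\<dots> = norm (z * of_real b - 1) * norm z"
    by (simp only: norm_mult complex_mod_cnj mult.commute)
  finally show ?thesis
    using assms by (auto simp: divide_le_eq)
qed

text \<open>
  Each term of the series for the logarithmic derivative is estimated through the distance of
  \<open>1\<close> from the line of real multiples of \<open>z\<close>, which is \<open>\<bar>Im z\<bar> / norm z\<close>.
\<close>

lemma logderiv_wprod_bound:
  assumes "Im z \<noteq> 0"
  shows "norm (deriv (wprod l \<beta>) z / wprod l \<beta> z) \<le> (\<Sum>j. \<bar>\<beta> j\<bar> ^ (l + 1)) * norm z ^ (l + 1) / \<bar>Im z\<bar>"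
proof -
  have z: "norm z > 0" using assms by auto
  have le: "norm (z ^ l * of_real (\<beta> j) ^ (l + 1) / (z * of_real (\<beta> j) - 1)) \<le> \<bar>\<beta> j\<bar> ^ (l + 1) * (norm z ^ (l + 1) / \<bar>Im z\<bar>)" for j
  proof -
    have "norm (z ^ l * of_real (\<beta> j) ^ (l + 1) / (z * of_real (\<beta> j) - 1))
        = norm z ^ l * \<bar>\<beta> j\<bar> ^ (l + 1) / norm (z * of_real (\<beta> j) - 1)"
      by (simp add: norm_mult norm_divide norm_power)
    also have "\<dots> \<le> norm z ^ l * \<bar>\<beta> j\<bar> ^ (l + 1) / (\<bar>Im z\<bar> / norm z)"
    proof -
      have "0 < \<bar>Im z\<bar> / norm z" using assms z by simp
      moreover have "\<bar>Im z\<bar> / norm z \<le> norm (z * of_real (\<beta> j) - 1)"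
        by (rule norm_linear_factor_ge[OF assms])
      ultimately show ?thesis
        by (intro divide_left_mono mult_pos_pos) auto
    qed
    finally show ?thesis by (simp add: mult_ac)
  qed
  have sm: "summable (\<lambda>j. \<bar>\<beta> j\<bar> ^ (l + 1) * (norm z ^ (l + 1) / \<bar>Im z\<bar>))"
    by (intro summable_mult2 summable_\<beta>)
  have "norm (deriv (wprod l \<beta>) z / wprod l \<beta> z) \<le> (\<Sum>j. \<bar>\<beta> j\<bar> ^ (l + 1) * (norm z ^ (l + 1) / \<bar>Im z\<bar>))"
    unfolding sums_unique[OF logderiv_wprod_sums[OF assms]]
    by (rule norm_suminf_le[OF le sm])
  also have "\<dots> = (\<Sum>j. \<bar>\<beta> j\<bar> ^ (l + 1)) * (norm z ^ (l + 1) / \<bar>Im z\<bar>)"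
    by (rule suminf_mult2[symmetric, OF summable_\<beta>])
  finally show ?thesis by simp
qed

end

text \<open>
  If the reciprocals are summable to a smaller power, the last exponential factors can be collected
  into one exponential of a monomial.
\<close>

lemma wprod_Suc:
  assumes "summable (\<lambda>j. \<bar>\<beta> j\<bar> ^ (l + 1))"
  shows "wprod (Suc l) \<beta> z = exp (of_real (\<Sum>j. \<beta> j ^ (l + 1)) * z ^ (l + 1) / of_nat (l + 1)) * wprod l \<beta> z"
proof -
  have sm: "summable (\<lambda>j. \<beta> j ^ (l + 1))"
    by (rule summable_rabs_cancel) (use assms in \<open>simp only: power_abs\<close>)
  have sums: "(\<lambda>j. of_real (\<beta> j ^ (l + 1)) * (z ^ (l + 1) / of_nat (l + 1))) sums
      (of_real (\<Sum>j. \<beta> j ^ (l + 1)) * (z ^ (l + 1) / of_nat (l + 1)))"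
    by (intro sums_mult2 sums_of_real summable_sums sm)
  have "weierstrass_factor (Suc l) (z * of_real b) =
      exp (of_real (b ^ (l + 1)) * (z ^ (l + 1) / of_nat (l + 1))) * weierstrass_factor l (z * of_real b)" for b
  proof -
    have "(\<Sum>k=1..Suc l. (z * of_real b) ^ k / of_nat k) =
        (\<Sum>k=1..l. (z * of_real b) ^ k / of_nat k) + of_real (b ^ (l + 1)) * (z ^ (l + 1) / of_nat (l + 1))"
      using power_mult_distrib[of z "of_real b" "Suc l"]
      by (simp only: sum.cl_ivl_Suc of_real_power Suc_eq_plus1) (simp add: mult.commute)
    then show ?thesis
      unfolding weierstrass_factor_def by (simp only: exp_add mult.assoc mult.left_commute mult.commute)
  qed
  then have "wprod (Suc l) \<beta> z = (\<Prod>j. exp (of_real (\<beta> j ^ (l + 1)) * (z ^ (l + 1) / of_nat (l + 1))) *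
      weierstrass_factor l (z * of_real (\<beta> j)))"
    by (simp only: wprod_def)
  also have "\<dots> = (\<Prod>j. exp (of_real (\<beta> j ^ (l + 1)) * (z ^ (l + 1) / of_nat (l + 1)))) * wprod l \<beta> z"
    unfolding wprod_def
    by (rule prodinf_mult[symmetric, OF convergent_prod_exp[OF sums_summable[OF sums]] wprod_convergent[OF assms]])
  also have "(\<Prod>j. exp (of_real (\<beta> j ^ (l + 1)) * (z ^ (l + 1) / of_nat (l + 1)))) =
      exp (of_real (\<Sum>j. \<beta> j ^ (l + 1)) * (z ^ (l + 1) / of_nat (l + 1)))"
    by (simp only: prodinf_exp[OF sums_summable[OF sums]] sums_unique[OF sums, symmetric])
  finally show ?thesis by (simp only: times_divide_eq_right)
qed

section \<open>Exponential factors and the classes\<close>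

lemma tendsto_inverse_power_axis:
  assumes "m > 0"
  shows "((\<lambda>y. 1 / (\<i> * complex_of_real y) ^ m) \<longlongrightarrow> 0) at_top"
proof (rule tendsto_norm_zero_cancel)
  have "((\<lambda>y::real. inverse (y ^ m)) \<longlongrightarrow> 0) at_top"
    by (intro tendsto_inverse_0_at_top filterlim_pow_at_top assms filterlim_ident)
  moreover have "\<forall>\<^sub>F y in at_top. norm (1 / (\<i> * complex_of_real y) ^ m) = inverse (y ^ m)"
    using eventually_gt_at_top[of 0]
    by eventually_elim (simp add: norm_divide norm_power norm_mult inverse_eq_divide)
  ultimately show "((\<lambda>y. norm (1 / (\<i> * complex_of_real y) ^ m)) \<longlongrightarrow> 0) at_top"
    by (simp cong: tendsto_cong)
qed

lemma poly_div_power_axis_lead_coeff: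
  "((\<lambda>y. poly a (\<i> * complex_of_real y) / (\<i> * complex_of_real y) ^ degree a) \<longlongrightarrow> lead_coeff a) at_top"
proof -
  let ?D = "degree a"
  have "((\<lambda>y. \<Sum>i\<le>?D. coeff a i * ((\<i> * complex_of_real y) ^ i / (\<i> * complex_of_real y) ^ ?D)) \<longlongrightarrow>
      (\<Sum>i\<le>?D. coeff a i * (if i = ?D then 1 else 0))) at_top"
  proof (intro tendsto_sum tendsto_mult_left)
    fix i assume "i \<in> {..?D}"
    show "((\<lambda>y. (\<i> * complex_of_real y) ^ i / (\<i> * complex_of_real y) ^ ?D) \<longlongrightarrow> (if i = ?D then 1 else 0)) at_top"
    proof (cases "i = ?D")
      case True
      have "\<forall>\<^sub>F y in at_top. (\<i> * complex_of_real y) ^ i / (\<i> * complex_of_real y) ^ ?D = 1"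
        using eventually_gt_at_top[of 0] by eventually_elim (simp add: True)
      then show ?thesis using True by (simp add: tendsto_eventually)
    next
      case False
      then have "((\<lambda>y. 1 / (\<i> * complex_of_real y) ^ (?D - i)) \<longlongrightarrow> 0) at_top"
        using \<open>i \<in> {..?D}\<close> by (intro tendsto_inverse_power_axis) auto
      moreover have "\<forall>\<^sub>F y in at_top. 1 / (\<i> * complex_of_real y) ^ (?D - i) =
          (\<i> * complex_of_real y) ^ i / (\<i> * complex_of_real y) ^ ?D"
        using eventually_gt_at_top[of 0]
      proof eventually_elim
        case (elim y)
        have "(\<i> * complex_of_real y) ^ ?D = (\<i> * complex_of_real y) ^ (?D - i) * (\<i> * complex_of_real y) ^ i"
          using \<open>i \<in> {..?D}\<close> by (simp flip: power_add)
        then show ?case using elim by simp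
      qed
      ultimately show ?thesis using False by (simp add: tendsto_cong)
    qed
  qed
  moreover have "(\<Sum>i\<le>?D. coeff a i * (if i = ?D then 1 else 0)) = lead_coeff a"
    by (simp add: if_distrib sum.delta cong: if_cong)
  ultimately show ?thesis
    by (simp add: poly_altdef sum_divide_distrib)
qed

text \<open>
  Divided by the power of \<open>z\<close> that matches its degree, a polynomial tends to its nonzero leading
  coefficient along the imaginary axis.
\<close>

lemma coeff_eq_0_of_axis_limit:
  assumes "((\<lambda>y. poly a (\<i> * complex_of_real y) / (\<i> * complex_of_real y) ^ k) \<longlongrightarrow> 0) at_top" "k \<le> i"
  shows "coeff a i = 0"
proof (rule ccontr)
  assume nz: "coeff a i \<noteq> 0"
  then have D: "k \<le> degree a" using le_degree[OF nz] assms(2) by simp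
  have "((\<lambda>y. poly a (\<i> * complex_of_real y) / (\<i> * complex_of_real y) ^ degree a) \<longlongrightarrow> 0) at_top"
  proof (rule Lim_null_comparison)
    show "((\<lambda>y. norm (poly a (\<i> * complex_of_real y) / (\<i> * complex_of_real y) ^ k)) \<longlongrightarrow> 0) at_top"
      using tendsto_norm_zero[OF assms(1)] .
    show "\<forall>\<^sub>F y in at_top. norm (poly a (\<i> * complex_of_real y) / (\<i> * complex_of_real y) ^ degree a)
        \<le> norm (poly a (\<i> * complex_of_real y) / (\<i> * complex_of_real y) ^ k)"
      using eventually_ge_at_top[of 1]
    proof eventually_elim
      case (elim y)
      then have "y ^ k \<le> y ^ degree a" "0 < y ^ k" "0 < y ^ degree a" using D by (auto intro: power_increasing)
      then show ?case
        using elim by (simp add: norm_divide norm_power norm_mult frac_le)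
    qed
  qed
  then have "lead_coeff a = 0"
    using tendsto_unique[OF _ poly_div_power_axis_lead_coeff] by auto
  then show False using nz by simp
qed

lemma poly_norm_le:
  fixes a :: "complex poly"
  obtains C where "C \<ge> 0" "\<And>z. norm (poly a z) \<le> C * (1 + norm z) ^ degree a"
proof
  show "0 \<le> (\<Sum>i\<le>degree a. norm (coeff a i))" by (simp add: sum_nonneg)
  fix z
  have "norm (poly a z) \<le> (\<Sum>i\<le>degree a. norm (coeff a i) * norm z ^ i)"
    unfolding poly_altdef by (rule sum_norm_le) (simp add: norm_mult norm_power)
  also have "\<dots> \<le> (\<Sum>i\<le>degree a. norm (coeff a i) * (1 + norm z) ^ degree a)"
  proof (intro sum_mono mult_left_mono)
    fix i assume "i \<in> {..degree a}"
    have "norm z ^ i \<le> (1 + norm z) ^ i" by (intro power_mono) auto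
    also have "\<dots> \<le> (1 + norm z) ^ degree a"
      using \<open>i \<in> {..degree a}\<close> by (intro power_increasing) auto
    finally show "norm z ^ i \<le> (1 + norm z) ^ degree a" .
  qed auto
  finally show "norm (poly a z) \<le> (\<Sum>i\<le>degree a. norm (coeff a i)) * (1 + norm z) ^ degree a"
    by (simp add: sum_distrib_right)
qed

abbreviation cpoly :: "real poly \<Rightarrow> complex poly" where
  "cpoly \<equiv> map_poly complex_of_real"

lemma cpoly_add: "cpoly (p + q) = cpoly p + cpoly q"
  by (rule poly_eqI) (simp add: coeff_map_poly)

lemma cpoly_monom: "cpoly (monom c k) = monom (of_real c) k"
  by (rule poly_eqI) (simp add: coeff_map_poly)

lemma cpoly_pderiv: "pderiv (cpoly p) = cpoly (pderiv p)"
  by (rule poly_eqI) (simp add: coeff_map_poly coeff_pderiv)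

lemma degree_cpoly [simp]: "degree (cpoly p) = degree p"
  by (rule degree_map_poly) auto

lemma poly_cpoly_of_real: "poly (cpoly p) (of_real x) = of_real (poly p x)"
  by (simp add: poly_altdef coeff_map_poly)

text \<open>
  Membership in \<open>V_class n\<close> with all data explicit: \<open>\<beta>\<close> lists the reciprocals of the nonzero
  zeros, and the two summands of the exponent are merged into the one real polynomial \<open>r\<close>, whose
  coefficient of degree \<open>2 * n + 2\<close> is \<open>- \<gamma>\<close>. The sequence \<open>\<beta>\<close> is a parameter because it
  stays fixed while the genus \<open>l\<close> and the exponent change.
\<close>

definition V_form ::
  "nat \<Rightarrow> nat \<Rightarrow> real poly \<Rightarrow> (nat \<Rightarrow> real) \<Rightarrow> real \<Rightarrow> nat \<Rightarrow> (complex \<Rightarrow> complex) \<Rightarrow> bool" where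
  "V_form n l r \<beta> c d f \<longleftrightarrow> c \<noteq> 0 \<and> degree r \<le> 2 * n + 2 \<and> coeff r (2 * n + 2) \<le> 0 \<and> l \<le> 2 * n + 1 \<and>
     summable (\<lambda>j. \<bar>\<beta> j\<bar> ^ (l + 1)) \<and>
     (\<forall>z. f z = of_real c * z ^ d * exp (poly (cpoly r) z) * wprod l \<beta> z)"

lemma V_class_iff_V_form:
  "f \<in> V_class n \<longleftrightarrow> (\<exists>\<omega> \<alpha>. (\<forall>j. 1 \<le> j \<and> enat j \<le> \<omega> \<longrightarrow> \<alpha> j \<noteq> 0) \<and>
     (\<exists>l r c d. V_form n l r (\<lambda>j. if 1 \<le> j \<and> enat j \<le> \<omega> then 1 / \<alpha> j else 0) c d f))"
proof -
  have factors: "(\<lambda>j. if 1 \<le> j \<and> enat j \<le> \<omega> then weierstrass_factor l (z / of_real (\<alpha> j)) else 1) =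
      (\<lambda>j. weierstrass_factor l (z * of_real (if 1 \<le> j \<and> enat j \<le> \<omega> then 1 / \<alpha> j else 0)))"
    for \<omega> and \<alpha> :: "nat \<Rightarrow> real" and l z by (auto simp: fun_eq_iff divide_inverse)
  have terms: "(\<lambda>j. if 1 \<le> j \<and> enat j \<le> \<omega> then 1 / \<bar>\<alpha> j\<bar> ^ (l + 1) else 0) =
      (\<lambda>j. \<bar>if 1 \<le> j \<and> enat j \<le> \<omega> then 1 / \<alpha> j else 0\<bar> ^ (l + 1))"
    for \<omega> and \<alpha> :: "nat \<Rightarrow> real" and l :: nat by (auto simp: fun_eq_iff abs_divide power_divide)
  show ?thesis
  proof
    assume "f \<in> V_class n"
    then obtain c d \<gamma> q \<omega> l \<alpha> where *: "c \<noteq> 0" "\<gamma> \<ge> 0" "degree q \<le> 2 * n + 1" "l \<le> 2 * n + 1"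
      "\<forall>j. 1 \<le> j \<and> enat j \<le> \<omega> \<longrightarrow> \<alpha> j \<noteq> 0"
      "summable (\<lambda>j. \<bar>if 1 \<le> j \<and> enat j \<le> \<omega> then 1 / \<alpha> j else 0\<bar> ^ (l + 1))"
      "\<forall>z. f z = of_real c * z ^ d * exp (- of_real \<gamma> * z ^ (2 * n + 2) + poly (cpoly q) z) *
         wprod l (\<lambda>j. if 1 \<le> j \<and> enat j \<le> \<omega> then 1 / \<alpha> j else 0) z"
      unfolding V_class_def mem_Collect_eq factors terms wprod_def by blast
    define r where "r = monom (- \<gamma>) (2 * n + 2) + q"
    have "degree r \<le> 2 * n + 2"
      unfolding r_def using *(3) by (intro degree_add_le degree_monom_le) auto
    moreover have "coeff r (2 * n + 2) \<le> 0"
      using *(2,3) by (simp add: r_def coeff_eq_0)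
    moreover have "poly (cpoly r) z = - of_real \<gamma> * z ^ (2 * n + 2) + poly (cpoly q) z" for z
      by (simp add: r_def cpoly_add cpoly_monom poly_monom)
    ultimately have "V_form n l r (\<lambda>j. if 1 \<le> j \<and> enat j \<le> \<omega> then 1 / \<alpha> j else 0) c d f"
      using * by (simp add: V_form_def)
    then show "\<exists>\<omega> \<alpha>. (\<forall>j. 1 \<le> j \<and> enat j \<le> \<omega> \<longrightarrow> \<alpha> j \<noteq> 0) \<and>
        (\<exists>l r c d. V_form n l r (\<lambda>j. if 1 \<le> j \<and> enat j \<le> \<omega> then 1 / \<alpha> j else 0) c d f)"
      using *(5) by blast
  next
    assume "\<exists>\<omega> \<alpha>. (\<forall>j. 1 \<le> j \<and> enat j \<le> \<omega> \<longrightarrow> \<alpha> j \<noteq> 0) \<and>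
        (\<exists>l r c d. V_form n l r (\<lambda>j. if 1 \<le> j \<and> enat j \<le> \<omega> then 1 / \<alpha> j else 0) c d f)"
    then obtain \<omega> \<alpha> l r c d where \<alpha>: "\<forall>j. 1 \<le> j \<and> enat j \<le> \<omega> \<longrightarrow> \<alpha> j \<noteq> 0"
      and V: "V_form n l r (\<lambda>j. if 1 \<le> j \<and> enat j \<le> \<omega> then 1 / \<alpha> j else 0) c d f" by blast
    define \<gamma> where "\<gamma> = - coeff r (2 * n + 2)"
    define q where "q = monom \<gamma> (2 * n + 2) + r"
    have deg: "degree q \<le> 2 * n + 1"
    proof (rule degree_le, intro allI impI)
      fix i assume "2 * n + 1 < i"
      then show "coeff q i = 0"
        using V coeff_eq_0[of r i] by (cases "i = 2 * n + 2") (auto simp: q_def \<gamma>_def V_form_def)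
    qed
    have eq: "poly (cpoly r) z = - of_real \<gamma> * z ^ (2 * n + 2) + poly (cpoly q) z" for z
      by (simp add: q_def cpoly_add cpoly_monom poly_monom)
    show "f \<in> V_class n"
      unfolding V_class_def mem_Collect_eq factors terms wprod_def[symmetric]
      by (rule exI[of _ c], rule exI[of _ d], rule exI[of _ \<gamma>], rule exI[of _ q],
          rule exI[of _ \<omega>], rule exI[of _ l], rule exI[of _ \<alpha>])
         (use V \<alpha> deg eq in \<open>auto simp: V_form_def \<gamma>_def\<close>)
  qed
qed

lemma V_form_lower_genus:
  assumes V: "V_form n (Suc l) r \<beta> c d f" and sm: "summable (\<lambda>j. \<bar>\<beta> j\<bar> ^ (l + 1))"
  shows "\<exists>r. V_form n l r \<beta> c d f"
proof -
  define B where "B = (\<Sum>j. \<beta> j ^ (l + 1))"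
  define r' where "r' = monom (B / real (l + 1)) (l + 1) + r"
  have l: "l + 1 \<le> 2 * n + 1" using V by (simp add: V_form_def)
  have "degree r' \<le> 2 * n + 2"
    unfolding r'_def using V l
    by (intro degree_add_le order_trans[OF degree_monom_le]) (auto simp: V_form_def)
  moreover have "coeff r' (2 * n + 2) \<le> 0"
    using V l by (auto simp: r'_def V_form_def)
  moreover have "exp (poly (cpoly r) z) * wprod (Suc l) \<beta> z = exp (poly (cpoly r') z) * wprod l \<beta> z" for z
    unfolding wprod_Suc[OF sm]
    by (simp add: r'_def B_def cpoly_add cpoly_monom poly_monom exp_add)
  ultimately show ?thesis
    using V sm by (intro exI[of _ r']) (auto simp: V_form_def mult.assoc)
qed

context
  fixes n l :: nat and r :: "real poly" and \<beta> :: "nat \<Rightarrow> real" and c :: real and d :: nat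
    and f :: "complex \<Rightarrow> complex"
  assumes V: "V_form n l r \<beta> c d f"
begin

lemma V_form_summable: "summable (\<lambda>j. \<bar>\<beta> j\<bar> ^ (l + 1))"
  using V by (simp add: V_form_def)

lemma V_form_eq: "f = (\<lambda>z. of_real c * z ^ d * exp (poly (cpoly r) z) * wprod l \<beta> z)"
  using V by (simp add: V_form_def fun_eq_iff)

lemma V_form_holomorphic: "f holomorphic_on UNIV"
  unfolding V_form_eq by (intro holomorphic_intros wprod_holomorphic V_form_summable)

lemma V_form_nonzero: "Im z \<noteq> 0 \<Longrightarrow> f z \<noteq> 0"
  using V wprod_nonzero[OF V_form_summable] by (auto simp: V_form_eq V_form_def)

lemma V_form_real: "f (of_real x) \<in> \<real>"
  unfolding V_form_eq poly_cpoly_of_real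
  by (intro Reals_mult Reals_power exp_in_Reals wprod_real V_form_summable) auto

lemma V_form_logderiv:
  assumes "Im z \<noteq> 0"
  shows "deriv f z / f z = of_nat d / z + poly (cpoly (pderiv r)) z + deriv (wprod l \<beta>) z / wprod l \<beta> z"
proof -
  have z: "z \<noteq> 0" using assms by auto
  have W: "wprod l \<beta> z \<noteq> 0" by (rule wprod_nonzero[OF V_form_summable assms])
  have "(wprod l \<beta> has_field_derivative deriv (wprod l \<beta>) z) (at z)"
    using wprod_holomorphic[OF V_form_summable] by (auto intro: holomorphic_derivI)
  then have "(f has_field_derivative
      (of_real c * (of_nat d * z ^ (d - 1)) * exp (poly (cpoly r) z) +
       of_real c * z ^ d * (exp (poly (cpoly r) z) * poly (pderiv (cpoly r)) z)) * wprod l \<beta> z +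
      of_real c * z ^ d * exp (poly (cpoly r) z) * deriv (wprod l \<beta>) z) (at z)"
    unfolding V_form_eq by (auto intro!: derivative_eq_intros simp: algebra_simps)
  then have "deriv f z =
      (of_real c * (of_nat d * z ^ (d - 1)) * exp (poly (cpoly r) z) +
       of_real c * z ^ d * (exp (poly (cpoly r) z) * poly (pderiv (cpoly r)) z)) * wprod l \<beta> z +
      of_real c * z ^ d * exp (poly (cpoly r) z) * deriv (wprod l \<beta>) z"
    by (rule DERIV_imp_deriv)
  also have "of_nat d * z ^ (d - 1) = of_nat d / z * z ^ d"
    using z by (cases d) auto
  also have "(of_real c * (of_nat d / z * z ^ d) * exp (poly (cpoly r) z) +
       of_real c * z ^ d * (exp (poly (cpoly r) z) * poly (pderiv (cpoly r)) z)) * wprod l \<beta> z +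
      of_real c * z ^ d * exp (poly (cpoly r) z) * deriv (wprod l \<beta>) z =
      f z * (of_nat d / z + poly (cpoly (pderiv r)) z + deriv (wprod l \<beta>) z / wprod l \<beta> z)"
    using W by (simp add: V_form_eq cpoly_pderiv distrib_left distrib_right mult_ac)
  finally show ?thesis
    using V_form_nonzero[OF assms] by simp
qed

lemma V_form_logderiv_bound:
  "\<exists>C K. \<forall>z. Im z \<noteq> 0 \<longrightarrow> norm (deriv f z / f z) \<le> C * (1 + norm z) ^ K / \<bar>Im z\<bar>"
proof -
  obtain A where A: "A \<ge> 0" "\<And>z. norm (poly (cpoly (pderiv r)) z) \<le> A * (1 + norm z) ^ degree (cpoly (pderiv r))"
    using poly_norm_le by blast
  define S where "S = (\<Sum>j. \<bar>\<beta> j\<bar> ^ (l + 1))"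
  have S: "S \<ge> 0" unfolding S_def by (intro suminf_nonneg V_form_summable) auto
  define K where "K = degree (pderiv r) + l + 2"
  have "norm (deriv f z / f z) \<le> (real d + A + S) * (1 + norm z) ^ K / \<bar>Im z\<bar>" if z: "Im z \<noteq> 0" for z
  proof -
    have Im: "\<bar>Im z\<bar> \<le> norm z" by (rule abs_Im_le_cmod)
    have pw: "(1 + norm z) ^ i \<le> (1 + norm z) ^ K" if "i \<le> K" for i
      using that by (intro power_increasing) auto
    have "norm (of_nat d / z) \<le> real d / \<bar>Im z\<bar>"
      using Im z by (simp add: norm_divide) (intro divide_left_mono mult_pos_pos; auto)
    also have "\<dots> \<le> real d * (1 + norm z) ^ K / \<bar>Im z\<bar>"
      using mult_left_mono[OF pw[of 0], of "real d"] by (intro divide_right_mono) auto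
    finally have 1: "norm (of_nat d / z) \<le> real d * (1 + norm z) ^ K / \<bar>Im z\<bar>" .
    have "norm (poly (cpoly (pderiv r)) z) * \<bar>Im z\<bar> \<le> A * (1 + norm z) ^ degree (pderiv r) * (1 + norm z)"
      using A(2)[of z] Im A(1) by (intro mult_mono) auto
    also have "\<dots> = A * (1 + norm z) ^ (degree (pderiv r) + 1)" by simp
    also have "\<dots> \<le> A * (1 + norm z) ^ K"
      by (intro mult_left_mono pw A) (simp add: K_def)
    finally have 2: "norm (poly (cpoly (pderiv r)) z) \<le> A * (1 + norm z) ^ K / \<bar>Im z\<bar>"
      using z by (simp add: pos_le_divide_eq)
    have "norm (deriv (wprod l \<beta>) z / wprod l \<beta> z) \<le> S * norm z ^ (l + 1) / \<bar>Im z\<bar>"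
      unfolding S_def by (rule logderiv_wprod_bound[OF V_form_summable z])
    also have "norm z ^ (l + 1) \<le> (1 + norm z) ^ (l + 1)" by (intro power_mono) auto
    also have "\<dots> \<le> (1 + norm z) ^ K" by (intro pw) (simp add: K_def)
    finally have 3: "norm (deriv (wprod l \<beta>) z / wprod l \<beta> z) \<le> S * (1 + norm z) ^ K / \<bar>Im z\<bar>"
      using S by (simp add: mult_left_mono divide_right_mono)
    show ?thesis
      unfolding V_form_logderiv[OF z]
      using norm_triangle_le[OF add_mono[OF norm_triangle_le[OF add_mono[OF 1 2]] 3]]
      by (simp add: distrib_right add_divide_distrib)
  qed
  then show ?thesis by blast
qed

end

section \<open>Slow growth lowers the class\<close>

lemma norm_axis_factor_ge:
  fixes y b :: real
  shows "1 \<le> norm (\<i> * of_real y * of_real b - 1)" "\<bar>y * b\<bar> \<le> norm (\<i> * of_real y * of_real b - 1)"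
  using abs_Re_le_cmod[of "\<i> * of_real y * of_real b - 1"] abs_Im_le_cmod[of "\<i> * of_real y * of_real b - 1"]
  by simp_all

lemma logderiv_wprod_axis_limit:
  assumes sm: "summable (\<lambda>j. \<bar>\<beta> j\<bar> ^ (l + 1))" and "l \<le> k"
  shows "((\<lambda>y. deriv (wprod l \<beta>) (\<i> * of_real y) / wprod l \<beta> (\<i> * of_real y) / (\<i> * of_real y) ^ k) \<longlongrightarrow> 0) at_top"
proof -
  define a where "a = (\<lambda>j y. (\<i> * complex_of_real y) ^ l * of_real (\<beta> j) ^ (l + 1) /
      (\<i> * complex_of_real y * of_real (\<beta> j) - 1) / (\<i> * complex_of_real y) ^ k)"
  have le: "norm (a j y) \<le> \<bar>\<beta> j\<bar> ^ (l + 1) / norm (\<i> * of_real y * of_real (\<beta> j) - 1)" if y: "y \<ge> 1" for j y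
  proof -
    have "norm (a j y) = y ^ l / y ^ k * (\<bar>\<beta> j\<bar> ^ (l + 1) / norm (\<i> * of_real y * of_real (\<beta> j) - 1))"
      using y by (simp add: a_def norm_mult norm_divide norm_power)
    also have "\<dots> \<le> 1 * (\<bar>\<beta> j\<bar> ^ (l + 1) / norm (\<i> * of_real y * of_real (\<beta> j) - 1))"
    proof (rule mult_right_mono)
      have "y ^ l \<le> y ^ k" using y \<open>l \<le> k\<close> by (intro power_increasing) auto
      then show "y ^ l / y ^ k \<le> 1" using y by simp
    qed simp
    finally show ?thesis by simp
  qed
  have lim: "((\<lambda>y. a j y) \<longlongrightarrow> 0) at_top" for j
  proof (cases "\<beta> j = 0")
    case True
    then show ?thesis by (simp add: a_def)
  next
    case False
    show ?thesis
    proof (rule Lim_null_comparison)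
      have "((\<lambda>y::real. inverse y) \<longlongrightarrow> 0) at_top"
        by (rule tendsto_inverse_0_at_top[OF filterlim_ident])
      then have "((\<lambda>y. \<bar>\<beta> j\<bar> ^ l * inverse y) \<longlongrightarrow> \<bar>\<beta> j\<bar> ^ l * 0) at_top"
        by (rule tendsto_mult_left)
      then show "((\<lambda>y. \<bar>\<beta> j\<bar> ^ l * inverse y) \<longlongrightarrow> 0) at_top" by simp
      show "\<forall>\<^sub>F y in at_top. norm (a j y) \<le> \<bar>\<beta> j\<bar> ^ l * inverse y"
        using eventually_ge_at_top[of 1]
      proof eventually_elim
        case (elim y)
        have "0 < \<bar>y * \<beta> j\<bar>" using elim False by simp
        have "norm (a j y) \<le> \<bar>\<beta> j\<bar> ^ (l + 1) / norm (\<i> * of_real y * of_real (\<beta> j) - 1)"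
          by (rule le[OF elim])
        also have "\<dots> \<le> \<bar>\<beta> j\<bar> ^ (l + 1) / \<bar>y * \<beta> j\<bar>"
          by (rule frac_le) (use norm_axis_factor_ge(2)[of y "\<beta> j"] \<open>0 < \<bar>y * \<beta> j\<bar>\<close> in auto)
        also have "\<dots> = \<bar>\<beta> j\<bar> ^ l * inverse y"
          using elim False by (simp add: abs_mult field_simps)
        finally show ?case .
      qed
    qed
  qed
  have "((\<lambda>y. \<Sum>j. a j y) \<longlongrightarrow> (\<Sum>j. 0)) at_top"
  proof (rule tannerys_theorem[THEN conjunct2, THEN conjunct2, OF lim _ sm])
    have "norm (a j y) \<le> \<bar>\<beta> j\<bar> ^ (l + 1)" if "y \<ge> 1" for j y
    proof -
      have "\<bar>\<beta> j\<bar> ^ (l + 1) / norm (\<i> * of_real y * of_real (\<beta> j) - 1) \<le> \<bar>\<beta> j\<bar> ^ (l + 1) / 1"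
        by (rule frac_le) (use norm_axis_factor_ge(1)[of y "\<beta> j"] in auto)
      then show ?thesis using le[OF that, of j] by simp
    qed
    then show "\<forall>\<^sub>F (j, y) in sequentially \<times>\<^sub>F at_top. norm (a j y) \<le> \<bar>\<beta> j\<bar> ^ (l + 1)"
      unfolding eventually_prod_filter
      by (intro exI[of _ "\<lambda>_. True"] exI[of _ "\<lambda>y. y \<ge> (1::real)"]) auto
  qed auto
  moreover have "\<forall>\<^sub>F y in at_top. (\<Sum>j. a j y) =
      deriv (wprod l \<beta>) (\<i> * of_real y) / wprod l \<beta> (\<i> * of_real y) / (\<i> * of_real y) ^ k"
    using eventually_gt_at_top[of 0]
  proof eventually_elim
    case (elim y)
    then have "Im (\<i> * of_real y) \<noteq> 0" by simp
    from sums_divide[OF logderiv_wprod_sums[OF sm this]] show ?case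
      unfolding a_def by (rule sums_unique[symmetric])
  qed
  ultimately show ?thesis by (simp add: tendsto_cong)
qed

text \<open>
  For \<open>l \<le> 2 * n - 1\<close> the series in the logarithmic derivative is of smaller order than
  \<open>y ^ (2 * n - 1)\<close> on the axis, by dominated convergence. Hence so is the polynomial part
  \<open>pderiv r\<close>, and its coefficients from degree \<open>2 * n - 1\<close> on vanish.
\<close>

lemma V_form_drop_low_genus:
  assumes V: "V_form n l r \<beta> c d f" and n: "n \<ge> 1" and l: "l \<le> 2 * n - 1"
    and lim: "((\<lambda>y. deriv f (\<i> * of_real y) / f (\<i> * of_real y) / (\<i> * of_real y) ^ (2 * n - 1)) \<longlongrightarrow> 0) at_top"
  shows "V_form (n - 1) l r \<beta> c d f"
proof -
  define k where "k = 2 * n - 1"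
  have "((\<lambda>y. of_nat d * (1 / (\<i> * complex_of_real y) ^ (k + 1))) \<longlongrightarrow> of_nat d * 0) at_top"
    by (intro tendsto_mult_left tendsto_inverse_power_axis) simp
  then have "((\<lambda>y. deriv f (\<i> * of_real y) / f (\<i> * of_real y) / (\<i> * of_real y) ^ k
      - of_nat d * (1 / (\<i> * complex_of_real y) ^ (k + 1))
      - deriv (wprod l \<beta>) (\<i> * of_real y) / wprod l \<beta> (\<i> * of_real y) / (\<i> * of_real y) ^ k) \<longlongrightarrow> 0 - of_nat d * 0 - 0) at_top"
    using lim l by (intro tendsto_diff logderiv_wprod_axis_limit V_form_summable[OF V]) (auto simp: k_def)
  moreover have "\<forall>\<^sub>F y in at_top. deriv f (\<i> * of_real y) / f (\<i> * of_real y) / (\<i> * of_real y) ^ k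
      - of_nat d * (1 / (\<i> * complex_of_real y) ^ (k + 1))
      - deriv (wprod l \<beta>) (\<i> * of_real y) / wprod l \<beta> (\<i> * of_real y) / (\<i> * of_real y) ^ k
      = poly (cpoly (pderiv r)) (\<i> * of_real y) / (\<i> * of_real y) ^ k"
    using eventually_gt_at_top[of 0]
  proof eventually_elim
    case (elim y)
    then have "Im (\<i> * of_real y) \<noteq> 0" by simp
    then show ?case
      unfolding V_form_logderiv[OF V \<open>Im (\<i> * of_real y) \<noteq> 0\<close>] by (simp add: add_divide_distrib)
  qed
  ultimately have "((\<lambda>y. poly (cpoly (pderiv r)) (\<i> * of_real y) / (\<i> * of_real y) ^ k) \<longlongrightarrow> 0) at_top"
    by (simp add: tendsto_cong)
  then have "coeff (cpoly (pderiv r)) i = 0" if "k \<le> i" for i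
    using coeff_eq_0_of_axis_limit that by blast
  then have "coeff (pderiv r) i = 0" if "k \<le> i" for i
    using that by (simp add: coeff_map_poly)
  then have coeff: "coeff r (Suc i) = 0" if "k \<le> i" for i
    using that by (simp add: coeff_pderiv del: of_nat_Suc)
  have "degree r \<le> k"
  proof (rule degree_le, intro allI impI)
    fix i assume "k < i"
    then show "coeff r i = 0" using coeff[of "i - 1"] by simp
  qed
  moreover have "coeff r (2 * (n - 1) + 2) = 0"
  proof -
    have "2 * (n - 1) + 2 = Suc k" using n by (simp add: k_def)
    then show ?thesis using coeff[of k] by (simp only: order_refl)
  qed
  ultimately show ?thesis
    using V n l by (auto simp: V_form_def k_def)
qed

text \<open>
  In the two highest genera every term of the series contributes a nonnegative real part after
  division by \<open>(\<i> y) ^ (2 * n - 1)\<close>, and that contribution increases to \<open>b ^ (2 * n)\<close>.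
\<close>

lemma Re_logderiv_term_axis:
  fixes y b :: real
  assumes y: "y > 0" and n: "n \<ge> 1" and l: "l = 2 * n \<or> l = 2 * n + 1"
  shows "Re ((\<i> * of_real y) ^ l * of_real b ^ (l + 1) / (\<i> * of_real y * of_real b - 1) / (\<i> * of_real y) ^ (2 * n - 1))
       = (b\<^sup>2) ^ n * ((b * y)\<^sup>2 / (1 + (b * y)\<^sup>2))"
proof -
  define w where "w = \<i> * complex_of_real y"
  have w: "w \<noteq> 0" using y by (simp add: w_def)
  define m where "m = l - (2 * n - 1)"
  have lm: "l = m + (2 * n - 1)" using l n by (auto simp: m_def)
  have "w ^ l * of_real b ^ (l + 1) / (w * of_real b - 1) / w ^ (2 * n - 1)
      = of_real (b ^ (l + 1)) * (w ^ m / (w * of_real b - 1))"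
    using w by (simp add: lm power_add)
  then have eq: "Re (w ^ l * of_real b ^ (l + 1) / (w * of_real b - 1) / w ^ (2 * n - 1))
      = b ^ (l + 1) * Re (w ^ m / (w * of_real b - 1))"
    by (simp only: times_complex.sel Re_complex_of_real Im_complex_of_real mult_zero_left diff_zero)
  have den: "(Re (w * of_real b - 1))\<^sup>2 + (Im (w * of_real b - 1))\<^sup>2 = 1 + (b * y)\<^sup>2"
    by (simp add: w_def mult.commute)
  from l show ?thesis
  proof
    assume "l = 2 * n"
    then have "m = 1" using n by (simp add: m_def)
    then have "Re (w ^ m / (w * of_real b - 1)) = y * (y * b) / (1 + (b * y)\<^sup>2)"
      unfolding Re_divide den by (simp add: w_def)
    moreover have pow: "b ^ (l + 1) = (b\<^sup>2) ^ n * b"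
      using \<open>l = 2 * n\<close> by (simp add: power_mult)
    ultimately show ?thesis
      unfolding w_def[symmetric] eq pow by (simp add: power2_eq_square mult_ac)
  next
    assume "l = 2 * n + 1"
    then have "m = 2" using n by (simp add: m_def)
    then have "Re (w ^ m / (w * of_real b - 1)) = y * y / (1 + (b * y)\<^sup>2)"
      unfolding Re_divide den by (simp add: w_def power2_eq_square)
    moreover have pow: "b ^ (l + 1) = (b\<^sup>2) ^ n * b\<^sup>2"
      using \<open>l = 2 * n + 1\<close> by (simp add: power_mult power2_eq_square)
    ultimately show ?thesis
      unfolding w_def[symmetric] eq pow by (simp add: power2_eq_square mult_ac)
  qed
qed

text \<open>
  The top coefficient meets \<open>(\<i> y)\<^sup>2 = - y\<^sup>2\<close> and so contributes with the good sign, the next one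
  is multiplied by the imaginary number \<open>\<i> y\<close>, and all others by numbers of norm at most 1.
\<close>

lemma Re_poly_div_power_axis_ge:
  assumes y: "y \<ge> 1" and n: "n \<ge> 1" and deg: "degree a \<le> 2 * n + 1" and top: "coeff a (2 * n + 1) \<le> 0"
  shows "- (\<Sum>i\<le>2 * n + 1. \<bar>coeff a i\<bar>) \<le>
    Re (poly (cpoly a) (\<i> * of_real y) / (\<i> * of_real y) ^ (2 * n - 1))"
proof -
  define w where "w = \<i> * complex_of_real y"
  have w: "w \<noteq> 0" using y by (simp add: w_def)
  have "poly (cpoly a) w = (\<Sum>i\<le>2 * n + 1. of_real (coeff a i) * w ^ i)"
  proof -
    have "poly (cpoly a) w = (\<Sum>i\<le>degree a. of_real (coeff a i) * w ^ i)"
      by (simp add: poly_altdef coeff_map_poly)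
    also have "\<dots> = (\<Sum>i\<le>2 * n + 1. of_real (coeff a i) * w ^ i)"
      by (rule sum.mono_neutral_left) (use deg in \<open>auto simp: coeff_eq_0\<close>)
    finally show ?thesis .
  qed
  then have "Re (poly (cpoly a) w / w ^ (2 * n - 1)) = (\<Sum>i\<le>2 * n + 1. coeff a i * Re (w ^ i / w ^ (2 * n - 1)))"
    by (simp add: sum_divide_distrib del: sum.atMost_Suc flip: times_divide_eq_right)
  moreover have "- \<bar>coeff a i\<bar> \<le> coeff a i * Re (w ^ i / w ^ (2 * n - 1))" if "i \<le> 2 * n + 1" for i
  proof -
    have "i = 2 * n + 1 \<or> i = 2 * n \<or> i \<le> 2 * n - 1" using that by arith
    then consider "i = 2 * n + 1" | "i = 2 * n" | "i \<le> 2 * n - 1" by blast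
    then show ?thesis
    proof cases
      case 1
      have "w ^ i = w\<^sup>2 * w ^ (2 * n - 1)"
        using 1 n by (simp flip: power_add)
      then have "Re (w ^ i / w ^ (2 * n - 1)) = - y\<^sup>2" using w by (simp add: w_def power2_eq_square)
      then show ?thesis using top 1 by (simp add: mult_nonpos_nonneg order_trans[of _ 0])
    next
      case 2
      have "w ^ i = w * w ^ (2 * n - 1)"
        using 2 n by (simp flip: power_Suc)
      then have "Re (w ^ i / w ^ (2 * n - 1)) = 0" using w by (simp add: w_def)
      then show ?thesis by simp
    next
      case 3
      have "\<bar>Re (w ^ i / w ^ (2 * n - 1))\<bar> \<le> norm (w ^ i / w ^ (2 * n - 1))"
        by (rule abs_Re_le_cmod)
      also have "\<dots> \<le> 1"
        using y 3 power_increasing[of i "2 * n - 1" y]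
        by (simp add: w_def norm_divide norm_power norm_mult)
      finally have "\<bar>coeff a i\<bar> * \<bar>Re (w ^ i / w ^ (2 * n - 1))\<bar> \<le> \<bar>coeff a i\<bar> * 1"
        by (intro mult_left_mono) auto
      then show ?thesis by (simp only: abs_mult[symmetric])
    qed
  qed
  then have "(\<Sum>i\<le>2 * n + 1. - \<bar>coeff a i\<bar>) \<le> (\<Sum>i\<le>2 * n + 1. coeff a i * Re (w ^ i / w ^ (2 * n - 1)))"
    by (intro sum_mono) auto
  ultimately show ?thesis by (simp add: w_def sum_negf)
qed

text \<open>
  Slow growth on the axis bounds the sum of the nonnegative real parts from the previous lemmas
  uniformly in \<open>y\<close>; letting \<open>y\<close> tend to infinity in each partial sum bounds the partial sums of
  \<open>\<bar>\<beta> j\<bar> ^ (2 * n)\<close>.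
\<close>

lemma V_form_summable_of_axis_limit:
  assumes V: "V_form n l r \<beta> c d f" and n: "n \<ge> 1" and l: "l = 2 * n \<or> l = 2 * n + 1"
    and lim: "((\<lambda>y. deriv f (\<i> * of_real y) / f (\<i> * of_real y) / (\<i> * of_real y) ^ (2 * n - 1)) \<longlongrightarrow> 0) at_top"
  shows "summable (\<lambda>j. \<bar>\<beta> j\<bar> ^ (2 * n))"
proof -
  define A where "A = (\<Sum>i\<le>2 * n + 1. \<bar>coeff (pderiv r) i\<bar>)"
  define b where "b = (\<lambda>j y. ((\<beta> j)\<^sup>2) ^ n * ((\<beta> j * y)\<^sup>2 / (1 + (\<beta> j * y)\<^sup>2)))"
  have partial: "(\<Sum>j<J. b j y) \<le> 1 + real d + A"
    if y: "y \<ge> 1" and small: "norm (deriv f (\<i> * of_real y) / f (\<i> * of_real y) / (\<i> * of_real y) ^ (2 * n - 1)) < 1" for y J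
  proof -
    define w where "w = \<i> * complex_of_real y"
    have Im: "Im w \<noteq> 0" using y by (simp add: w_def)
    have "(\<lambda>j. Re (w ^ l * of_real (\<beta> j) ^ (l + 1) / (w * of_real (\<beta> j) - 1) / w ^ (2 * n - 1))) sums
        Re (deriv (wprod l \<beta>) w / wprod l \<beta> w / w ^ (2 * n - 1))"
      by (intro sums_Re sums_divide logderiv_wprod_sums V_form_summable[OF V] Im)
    also have "(\<lambda>j. Re (w ^ l * of_real (\<beta> j) ^ (l + 1) / (w * of_real (\<beta> j) - 1) / w ^ (2 * n - 1))) = (\<lambda>j. b j y)"
      unfolding w_def b_def using Re_logderiv_term_axis[OF _ n l] y by (intro ext) simp
    finally have sums: "(\<lambda>j. b j y) sums Re (deriv (wprod l \<beta>) w / wprod l \<beta> w / w ^ (2 * n - 1))" .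
    have "(\<Sum>j<J. b j y) \<le> Re (deriv (wprod l \<beta>) w / wprod l \<beta> w / w ^ (2 * n - 1))"
      unfolding sums_unique[OF sums] by (rule sum_le_suminf[OF sums_summable[OF sums]]) (auto simp: b_def)
    also have "\<dots> = Re (deriv f w / f w / w ^ (2 * n - 1)) - Re (of_nat d / w / w ^ (2 * n - 1))
        - Re (poly (cpoly (pderiv r)) w / w ^ (2 * n - 1))"
      unfolding V_form_logderiv[OF V Im] by (simp add: add_divide_distrib)
    also have "\<dots> \<le> 1 + real d + A"
    proof -
      have "Re (deriv f w / f w / w ^ (2 * n - 1)) \<le> 1"
        using small complex_Re_le_cmod[of "deriv f w / f w / w ^ (2 * n - 1)"] unfolding w_def by linarith
      moreover have "\<bar>Re (of_nat d / w / w ^ (2 * n - 1))\<bar> \<le> real d"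
      proof -
        have "\<bar>Re (of_nat d / w / w ^ (2 * n - 1))\<bar> \<le> norm (of_nat d / w / w ^ (2 * n - 1))"
          by (rule abs_Re_le_cmod)
        also have "\<dots> = real d / (y * y ^ (2 * n - 1))"
          using y by (simp add: w_def norm_divide norm_mult norm_power)
        also have "\<dots> \<le> real d / 1"
          using y by (intro frac_le) (auto simp flip: power_Suc)
        finally show ?thesis by simp
      qed
      moreover have "- A \<le> Re (poly (cpoly (pderiv r)) w / w ^ (2 * n - 1))"
        unfolding A_def w_def
      proof (rule Re_poly_div_power_axis_ge[OF y n])
        show "degree (pderiv r) \<le> 2 * n + 1" using V by (auto simp: degree_pderiv V_form_def)
        show "coeff (pderiv r) (2 * n + 1) \<le> 0"
          using V by (simp add: coeff_pderiv V_form_def mult_nonneg_nonpos)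
      qed
      ultimately show ?thesis by linarith
    qed
    finally show ?thesis .
  qed
  have b_lim: "((\<lambda>y. b j y) \<longlongrightarrow> \<bar>\<beta> j\<bar> ^ (2 * n)) at_top" for j
  proof (cases "\<beta> j = 0")
    case True
    then show ?thesis using n by (simp add: b_def power_0_left)
  next
    case False
    have "((\<lambda>y. (t * y)\<^sup>2 / (1 + (t * y)\<^sup>2)) \<longlongrightarrow> 1) at_top" if "t > 0" for t :: real
      using that by real_asymp
    from this[of "\<bar>\<beta> j\<bar>"] have "((\<lambda>y. (\<beta> j * y)\<^sup>2 / (1 + (\<beta> j * y)\<^sup>2)) \<longlongrightarrow> 1) at_top"
      using False by (simp add: power_mult_distrib)
    then have "((\<lambda>y. b j y) \<longlongrightarrow> ((\<beta> j)\<^sup>2) ^ n * 1) at_top"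
      unfolding b_def by (rule tendsto_mult_left)
    then show ?thesis by (simp add: power_mult)
  qed
  show ?thesis
  proof (rule summableI_nonneg_bounded)
    fix J
    show "(\<Sum>j<J. \<bar>\<beta> j\<bar> ^ (2 * n)) \<le> 1 + real d + A"
    proof (rule tendsto_upperbound)
      show "((\<lambda>y. \<Sum>j<J. b j y) \<longlongrightarrow> (\<Sum>j<J. \<bar>\<beta> j\<bar> ^ (2 * n))) at_top"
        by (intro tendsto_sum b_lim)
      have "\<forall>\<^sub>F y in at_top. norm (deriv f (\<i> * of_real y) / f (\<i> * of_real y) / (\<i> * of_real y) ^ (2 * n - 1)) < 1"
        using order_tendstoD(2)[OF tendsto_norm_zero[OF lim], of 1] by simp
      then show "\<forall>\<^sub>F y in at_top. (\<Sum>j<J. b j y) \<le> 1 + real d + A"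
        using eventually_ge_at_top[of 1] by eventually_elim (rule partial)
    qed simp
  qed auto
qed

text \<open>
  A function in \<open>V_class n\<close> whose logarithmic derivative is of smaller order than \<open>y ^ (2 * n - 1)\<close>
  on the imaginary axis lies in \<open>V_class (n - 1)\<close>: if the genus exceeds \<open>2 * n - 1\<close>, the zeros are
  sparse enough to lower it to that value.
\<close>

theorem V_form_drop:
  assumes V: "V_form n l r \<beta> c d f" and n: "n \<ge> 1"
    and lim: "((\<lambda>y. deriv f (\<i> * of_real y) / f (\<i> * of_real y) / (\<i> * of_real y) ^ (2 * n - 1)) \<longlongrightarrow> 0) at_top"
  shows "\<exists>l r. V_form (n - 1) l r \<beta> c d f"
proof (cases "l \<le> 2 * n - 1")
  case True
  then show ?thesis using V_form_drop_low_genus[OF V n _ lim] by blast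
next
  case False
  then have l: "l = 2 * n \<or> l = 2 * n + 1" using V n by (auto simp: V_form_def)
  have sm: "summable (\<lambda>j. \<bar>\<beta> j\<bar> ^ (2 * n - 1 + 1))"
    using V_form_summable_of_axis_limit[OF V n l lim] n by simp
  have reduce: "\<exists>r. V_form n (2 * n - 1) r \<beta> c d f" if "V_form n (2 * n) r' \<beta> c d f" for r'
    using V_form_lower_genus[of n "2 * n - 1" r'] that sm n by simp
  have "\<exists>r. V_form n (2 * n - 1) r \<beta> c d f"
    using l
  proof
    assume "l = 2 * n"
    then show ?thesis using reduce V by blast
  next
    assume l: "l = 2 * n + 1"
    have "summable (\<lambda>j. \<bar>\<beta> j\<bar> ^ (2 * n + 1))"
    proof (rule summable_comparison_test_ev[OF _ sm])
      show "\<forall>\<^sub>F j in sequentially. norm (\<bar>\<beta> j\<bar> ^ (2 * n + 1)) \<le> \<bar>\<beta> j\<bar> ^ (2 * n - 1 + 1)"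
        using eventually_small[OF sm, of 1]
      proof (rule eventually_mono)
        fix j assume "1 * \<bar>\<beta> j\<bar> < 1 / 2"
        then show "norm (\<bar>\<beta> j\<bar> ^ (2 * n + 1)) \<le> \<bar>\<beta> j\<bar> ^ (2 * n - 1 + 1)"
          using power_decreasing[of "2 * n - 1 + 1" "2 * n + 1" "\<bar>\<beta> j\<bar>"] by simp
      qed simp
    qed
    moreover have "V_form n (Suc (2 * n)) r \<beta> c d f" using V l by simp
    ultimately obtain r' where "V_form n (2 * n) r' \<beta> c d f"
      using V_form_lower_genus by blast
    then show ?thesis by (rule reduce)
  qed
  then show ?thesis using V_form_drop_low_genus[OF _ n _ lim] by blast
qed

section \<open>Counting\<close>

lemma zorder_poly:
  assumes "p \<noteq> 0"
  shows "zorder (poly p) z = int (order z p)"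
proof -
  obtain q where q: "p = [:-z, 1:] ^ order z p * q" "\<not> [:-z, 1:] dvd q"
    using order_decomp[OF assms] by blast
  show ?thesis
  proof (rule zorder_eqI[where S = UNIV and g = "poly q"])
    show "poly q z \<noteq> 0" using q(2) by (simp add: poly_eq_0_iff_dvd)
    show "poly p w = poly q w * (w - z) powi int (order z p)" for w
      by (subst q(1)) (simp add: poly_mult poly_power)
  qed (auto intro!: holomorphic_intros)
qed

text \<open>
  All nonreal zeros of the product come from the polynomial factor.
\<close>

lemma nonreal_zeros_le_degree:
  assumes \<phi>: "\<And>z. \<phi> z = poly p z * f z" and p: "p \<noteq> 0"
    and f: "f holomorphic_on UNIV" "\<And>z. Im z \<noteq> 0 \<Longrightarrow> f z \<noteq> 0"
    and count: "nonreal_zeros \<phi> = enat M"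
  shows "M \<le> degree p"
proof -
  define C where "C = {z \<in> - \<real>. zero_mult \<phi> z \<noteq> 0}"
  have mult: "zero_mult \<phi> z = enat (order z p)" if "z \<notin> \<real>" for z
  proof -
    have nz: "f z \<noteq> 0" using f(2)[of z] that complex_is_Real_iff by blast
    have f_nz: "\<exists>z. f z \<noteq> 0" using nz by blast
    have p_nz: "\<exists>z. poly p z \<noteq> 0" using p by (metis poly_all_0_iff_0)
    have p_holo: "poly p holomorphic_on UNIV" by (intro holomorphic_intros)
    have \<phi>_holo: "\<phi> holomorphic_on UNIV"
      unfolding \<phi>[abs_def] by (intro holomorphic_intros f)
    have "\<forall>\<^sub>F w in at z. f w \<noteq> 0"
      using f(1) by (intro non_zero_neighbour entire_frequently_nonzero[OF f(1) f_nz]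
          isolated_singularity_at_analytic not_essential_analytic holomorphic_on_imp_analytic_at[of _ UNIV]) auto
    then have "\<exists>\<^sub>F w in at z. f w \<noteq> 0 \<and> poly p w \<noteq> 0"
      by (intro frequently_eventually_conj entire_frequently_nonzero[OF p_holo p_nz])
    then obtain z0 where z0: "\<phi> z0 \<noteq> 0"
      by (auto simp: \<phi> dest: frequently_ex)
    have "zorder \<phi> z = zorder (poly p) z + zorder f z"
      unfolding \<phi>[abs_def]
      by (intro zorder_mult entire_frequently_nonzero p_holo f(1) p_nz f_nz analytic_on_imp_meromorphic_on
          holomorphic_on_imp_analytic_at[of _ UNIV]) auto
    also have "zorder f z = 0"
      using f(1) nz by (intro zorder_eq_0I holomorphic_on_imp_analytic_at[of _ UNIV]) auto
    finally show ?thesis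
      using zero_mult_entire[OF \<phi>_holo, of z] z0 by (auto simp: zorder_poly[OF p])
  qed
  have fin: "finite {z. poly p z = 0}" by (rule poly_roots_finite[OF p])
  have "C \<subseteq> {z. poly p z = 0}"
    using p by (auto simp: C_def mult zero_enat_def order_root)
  moreover from this have "finite C" using fin finite_subset by blast
  moreover have "enat M = (\<Sum>z\<in>C. enat (order z p))"
  proof -
    have "enat M = (\<Sum>z\<in>C. zero_mult \<phi> z)"
      using count \<open>finite C\<close> by (simp add: zero_count_def C_def)
    also have "\<dots> = (\<Sum>z\<in>C. enat (order z p))"
      by (rule sum.cong) (auto simp: C_def mult)
    finally show ?thesis .
  qed
  moreover have "(\<Sum>z\<in>C. enat (order z p)) = enat (\<Sum>z\<in>C. order z p)"
    using \<open>finite C\<close> by induction (auto simp: zero_enat_def)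
  ultimately have "M \<le> (\<Sum>z | poly p z = 0. order z p)"
    using fin by (simp add: sum_mono2)
  also have "\<dots> \<le> degree p" by (rule sum_order_le_degree[OF p])
  finally show ?thesis .
qed

lemma poly_axis_lower_bound:
  fixes a :: "complex poly"
  assumes "a \<noteq> 0"
  obtains c where "c > 0" "\<forall>\<^sub>F y in at_top. c * y ^ degree a \<le> norm (poly a (\<i> * complex_of_real y))"
proof
  define c where "c = norm (lead_coeff a) / 2"
  show "c > 0" using assms by (simp add: c_def)
  have "((\<lambda>y. norm (poly a (\<i> * complex_of_real y) / (\<i> * complex_of_real y) ^ degree a)) \<longlongrightarrow> norm (lead_coeff a)) at_top"
    by (intro tendsto_norm poly_div_power_axis_lead_coeff)
  then have "\<forall>\<^sub>F y in at_top. c < norm (poly a (\<i> * complex_of_real y) / (\<i> * complex_of_real y) ^ degree a)"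
    by (rule order_tendstoD) (use assms in \<open>simp add: c_def\<close>)
  then show "\<forall>\<^sub>F y in at_top. c * y ^ degree a \<le> norm (poly a (\<i> * complex_of_real y))"
    using eventually_gt_at_top[of 0]
    by eventually_elim (simp add: norm_divide norm_mult norm_power field_simps)
qed

theorem theorem5p22:
  fixes n m m\<^sub>1 :: nat and \<phi> Q :: "complex \<Rightarrow> complex"
  assumes "n \<ge> 1"
    and "\<phi> \<in> U_star n"
    and "nonreal_zeros \<phi> = enat (2 * m)"
    and "Q = deriv (\<lambda>z. deriv \<phi> z / \<phi> z)"
    and "nonreal_zeros (deriv \<phi>) = enat (2 * m\<^sub>1)"
  shows "ereal_of_enat (real_zeros Q) \<ge> ereal (2 * real m - 2 * real m\<^sub>1 + 2 * real n - 2)"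
proof (cases "real_zeros Q")
  case infinity
  then show ?thesis by simp
next
  case (enat N\<^sub>0)
  note n = \<open>n \<ge> 1\<close>
  obtain f p where f: "f \<in> V_class n" "f \<notin> V_class (n - 1)"
    and p: "\<And>x. poly p x \<noteq> 0" and \<phi>: "\<And>z. \<phi> z = poly (cpoly p) z * f z"
    using assms(2) n by (auto simp: U_star_def U_class_def)
  obtain \<omega> and \<alpha> :: "nat \<Rightarrow> real" and l r c d where \<alpha>: "\<forall>j. 1 \<le> j \<and> enat j \<le> \<omega> \<longrightarrow> \<alpha> j \<noteq> 0"
    and V: "V_form n l r (\<lambda>j. if 1 \<le> j \<and> enat j \<le> \<omega> then 1 / \<alpha> j else 0) c d f"
    using f(1) unfolding V_class_iff_V_form by blast
  define \<beta> where "\<beta> = (\<lambda>j. if 1 \<le> j \<and> enat j \<le> \<omega> then 1 / \<alpha> j else 0)"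
  note V = V[folded \<beta>_def]
  have f_holo: "f holomorphic_on UNIV" by (rule V_form_holomorphic[OF V])
  have f_nz: "f z \<noteq> 0" if "Im z \<noteq> 0" for z by (rule V_form_nonzero[OF V that])
  define P where "P = cpoly p"
  define g where "g = degree P"
  have P_real: "poly P (of_real x) \<noteq> 0" for x using p by (simp add: P_def poly_cpoly_of_real)
  then have P: "P \<noteq> 0" by auto
  have P_holo: "poly P holomorphic_on UNIV" by (intro holomorphic_intros)
  have \<phi>P: "\<phi> z = poly P z * f z" for z by (simp add: \<phi> P_def)
  have d\<phi>: "deriv \<phi> z = poly (pderiv P) z * f z + poly P z * deriv f z" for z
  proof -
    have "(f has_field_derivative deriv f z) (at z)"
      using f_holo by (auto intro: holomorphic_derivI)
    then have "(\<phi> has_field_derivative poly (pderiv P) z * f z + deriv f z * poly P z) (at z)"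
      unfolding \<phi>P[abs_def] by (intro DERIV_mult poly_DERIV)
    then show ?thesis by (simp add: DERIV_imp_deriv mult.commute)
  qed
  define N where "N = (\<lambda>z. deriv \<phi> z / f z)"
  have N: "N z = poly (pderiv P) z + poly P z * (deriv f z / f z)" if "Im z \<noteq> 0" for z
    using f_nz[OF that] by (simp add: N_def d\<phi> add_divide_distrib)
  have \<phi>_real: "\<phi> (of_real x) \<in> \<real>" for x
    using V_form_real[OF V, of x] by (simp add: \<phi> poly_cpoly_of_real)
  have finQ: "zero_count (deriv (\<lambda>z. deriv \<phi> z / \<phi> z)) \<real> = enat N\<^sub>0"
    using enat assms(4) by simp
  have "\<exists>(X :: real set) \<sigma> (E :: complex set) (e :: complex \<Rightarrow> nat). alternating X \<sigma> \<and> (\<forall>R. finite (X \<inter> {-R..R})) \<and> finite E \<and>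
    sum e E \<le> N\<^sub>0 + 2 * m\<^sub>1 \<and>
    (\<forall>z. zorder (\<lambda>z. deriv \<phi> z / f z) z =
        (if z \<in> of_real ` X then \<sigma> (Re z) else 0) + (if z \<in> E then int (e z) else 0))"
    by (rule divisor_of_deriv_quotient[OF \<phi>P P_holo P_real f_holo f_nz \<phi>_real assms(5) finQ])
  then obtain X \<sigma> E e where divisor: "alternating X \<sigma> \<and> (\<forall>R. finite (X \<inter> {-R..R})) \<and> finite E \<and>
    sum e E \<le> N\<^sub>0 + 2 * m\<^sub>1 \<and>
    (\<forall>z. zorder (\<lambda>z. deriv \<phi> z / f z) z =
        (if z \<in> of_real ` X then \<sigma> (Re z) else 0) + (if z \<in> E then int (e z) else 0))"
    by (elim exE)
  then have X: "alternating X \<sigma>" "\<And>R. finite (X \<inter> {-R..R})" and E: "finite E"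
    and e: "sum e E \<le> N\<^sub>0 + 2 * m\<^sub>1"
    by simp_all
  have zorder: "zorder N z =
      (if z \<in> of_real ` X then \<sigma> (Re z) else 0) + (if z \<in> E then int (e z) else 0)" for z
    unfolding N_def using divisor by simp
  have d_holo: "deriv \<phi> holomorphic_on UNIV"
    unfolding \<phi>P[abs_def] by (intro holomorphic_deriv holomorphic_intros f_holo) auto
  have ana: "h analytic_on {z}" if "h holomorphic_on UNIV" for h :: "complex \<Rightarrow> complex" and z
    using that by (auto intro: holomorphic_on_imp_analytic_at)
  have N_bound: "\<exists>C K. \<forall>z. Im z \<noteq> 0 \<longrightarrow> norm (N z) \<le> C * (1 + norm z) ^ K / \<bar>Im z\<bar> ^ 1"
  proof -
    obtain A where A: "A \<ge> 0" "\<And>z. norm (poly P z) \<le> A * (1 + norm z) ^ degree P"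
      using poly_norm_le by blast
    obtain A' where A': "A' \<ge> 0" "\<And>z. norm (poly (pderiv P) z) \<le> A' * (1 + norm z) ^ degree (pderiv P)"
      using poly_norm_le by blast
    obtain C K where C: "\<And>z. Im z \<noteq> 0 \<Longrightarrow> norm (deriv f z / f z) \<le> C * (1 + norm z) ^ K / \<bar>Im z\<bar>"
      using V_form_logderiv_bound[OF V] by blast
    define K' where "K' = degree P + K + degree (pderiv P) + 1"
    have "norm (N z) \<le> (A' + A * \<bar>C\<bar>) * (1 + norm z) ^ K' / \<bar>Im z\<bar> ^ 1" if z: "Im z \<noteq> 0" for z
    proof -
      have pw: "(1 + norm z) ^ i \<le> (1 + norm z) ^ K'" if "i \<le> K'" for i
        using that by (intro power_increasing) auto
      have "norm (poly (pderiv P) z) * \<bar>Im z\<bar> \<le> A' * (1 + norm z) ^ degree (pderiv P) * (1 + norm z)"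
        using A'(2)[of z] A'(1) abs_Im_le_cmod[of z] by (intro mult_mono) auto
      also have "\<dots> = A' * (1 + norm z) ^ (degree (pderiv P) + 1)" by simp
      also have "\<dots> \<le> A' * (1 + norm z) ^ K'"
        by (intro mult_left_mono pw A') (simp add: K'_def)
      finally have 1: "norm (poly (pderiv P) z) \<le> A' * (1 + norm z) ^ K' / \<bar>Im z\<bar>"
        using z by (simp add: pos_le_divide_eq)
      have "norm (deriv f z / f z) \<le> \<bar>C\<bar> * (1 + norm z) ^ K / \<bar>Im z\<bar>"
        using C[OF z] by (rule order_trans) (intro divide_right_mono mult_right_mono; simp)
      then have "norm (poly P z * (deriv f z / f z)) \<le> A * (1 + norm z) ^ degree P * (\<bar>C\<bar> * (1 + norm z) ^ K / \<bar>Im z\<bar>)"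
        unfolding norm_mult[of "poly P z"] using A by (intro mult_mono) auto
      also have "\<dots> = A * \<bar>C\<bar> * (1 + norm z) ^ (degree P + K) / \<bar>Im z\<bar>" by (simp add: power_add)
      also have "\<dots> \<le> A * \<bar>C\<bar> * (1 + norm z) ^ K' / \<bar>Im z\<bar>"
        using A(1) by (intro divide_right_mono mult_left_mono pw) (auto simp: K'_def)
      finally have 2: "norm (poly P z * (deriv f z / f z)) \<le> A * \<bar>C\<bar> * (1 + norm z) ^ K' / \<bar>Im z\<bar>" .
      show ?thesis
        unfolding N[OF z] using norm_triangle_le[OF add_mono[OF 1 2]]
        by (simp add: distrib_right add_divide_distrib)
    qed
    then show ?thesis by blast
  qed
  then obtain C K where CK: "\<And>z. Im z \<noteq> 0 \<Longrightarrow> norm (N z) \<le> C * (1 + norm z) ^ K / \<bar>Im z\<bar> ^ 1" by blast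
  have "\<exists>C s. 0 < s \<and> (\<forall>y\<ge>s. norm (N (\<i> * of_real y)) \<le> C * y ^ (sum e E + 1))"
  proof (rule growth_from_alternating_divisor[OF _ _ _ X E zorder CK])
    show "N meromorphic_on UNIV"
      unfolding N_def using d_holo f_holo
      by (intro meromorphic_intros analytic_on_imp_meromorphic_on) (auto simp: analytic_on_open)
    show "N analytic_on {z}" if "Im z \<noteq> 0" for z
      unfolding N_def using f_nz[OF that] by (intro analytic_intros ana d_holo f_holo) auto
    show "\<exists>\<^sub>F w in at z. N w \<noteq> 0" for z
    proof -
      have "\<exists>z. deriv \<phi> z \<noteq> 0" by (rule zero_count_finite_imp_nonzero[OF assms(5)])
      then have "\<exists>\<^sub>F w in at z. deriv \<phi> w \<noteq> 0" by (rule entire_frequently_nonzero[OF d_holo])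
      moreover have "\<forall>\<^sub>F w in at z. f w \<noteq> 0"
        using entire_frequently_nonzero[OF f_holo] f_nz[of \<i>]
        by (intro non_zero_neighbour isolated_singularity_at_analytic not_essential_analytic ana f_holo) auto
      ultimately show ?thesis
        by (rule frequently_rev_mp[OF _ eventually_mono]) (auto simp: N_def)
    qed
  qed
  then obtain C s where Cs: "\<And>y. y \<ge> s \<Longrightarrow> norm (N (\<i> * of_real y)) \<le> C * y ^ (sum e E + 1)" by blast
  \<comment> \<open>Otherwise \<open>f' / f = (N - p') / p\<close> would be of order at most \<open>y ^ (2 * n - 2)\<close>.\<close>
  have D: "g + 2 * n - 2 \<le> sum e E"
  proof (rule ccontr)
    assume "\<not> ?thesis"
    then have D: "sum e E + 1 \<le> g + (2 * n - 2)" using n by linarith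
    obtain c0 where c0: "c0 > 0" "\<forall>\<^sub>F y in at_top. c0 * y ^ g \<le> norm (poly P (\<i> * complex_of_real y))"
      unfolding g_def using poly_axis_lower_bound[OF P] by blast
    obtain A where A: "A \<ge> 0" "\<And>z. norm (poly (pderiv P) z) \<le> A * (1 + norm z) ^ degree (pderiv P)"
      using poly_norm_le by blast
    define B where "B = (\<bar>C\<bar> + A * 2 ^ g) / c0"
    have "((\<lambda>y. deriv f (\<i> * of_real y) / f (\<i> * of_real y) / (\<i> * of_real y) ^ (2 * n - 1)) \<longlongrightarrow> 0) at_top"
    proof (rule Lim_null_comparison)
      have "((\<lambda>y::real. inverse y) \<longlongrightarrow> 0) at_top"
        by (rule tendsto_inverse_0_at_top[OF filterlim_ident])
      then have "((\<lambda>y. B * inverse y) \<longlongrightarrow> B * 0) at_top"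
        by (rule tendsto_mult_left)
      then show "((\<lambda>y. B * inverse y) \<longlongrightarrow> 0) at_top" by simp
      show "\<forall>\<^sub>F y in at_top. norm (deriv f (\<i> * of_real y) / f (\<i> * of_real y) / (\<i> * of_real y) ^ (2 * n - 1)) \<le> B * inverse y"
        using c0(2) eventually_ge_at_top[of 1] eventually_ge_at_top[of s]
      proof eventually_elim
        case (elim y)
        define w where "w = \<i> * complex_of_real y"
        have w: "Im w \<noteq> 0" "norm w = y" using elim by (auto simp: w_def norm_mult)
        have pos: "0 < c0 * y ^ g" using c0(1) elim by simp
        then have P_pos: "poly P w \<noteq> 0" using elim(1) by (auto simp: w_def)
        have "norm (N w) \<le> \<bar>C\<bar> * y ^ (g + (2 * n - 2))"
        proof -
          have "norm (N w) \<le> C * y ^ (sum e E + 1)" using Cs elim by (simp add: w_def)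
          also have "\<dots> \<le> \<bar>C\<bar> * y ^ (g + (2 * n - 2))"
            using elim D by (intro mult_mono power_increasing) auto
          finally show ?thesis .
        qed
        moreover have "norm (poly (pderiv P) w) \<le> A * 2 ^ g * y ^ (g + (2 * n - 2))"
        proof -
          have "norm (poly (pderiv P) w) \<le> A * (1 + y) ^ degree (pderiv P)" using A(2)[of w] w by simp
          also have "\<dots> \<le> A * (2 * y) ^ g"
          proof (rule mult_left_mono[OF _ A(1)])
            have "(1 + y) ^ degree (pderiv P) \<le> (1 + y) ^ g"
              using elim by (intro power_increasing) (auto simp: g_def degree_pderiv)
            also have "\<dots> \<le> (2 * y) ^ g" using elim by (intro power_mono) auto
            finally show "(1 + y) ^ degree (pderiv P) \<le> (2 * y) ^ g" .
          qed
          also have "\<dots> \<le> A * 2 ^ g * y ^ (g + (2 * n - 2))"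
            unfolding power_mult_distrib mult.assoc using elim A(1)
            by (intro mult_left_mono power_increasing) auto
          finally show ?thesis .
        qed
        ultimately have num: "norm (N w - poly (pderiv P) w) \<le> c0 * B * y ^ (g + (2 * n - 2))"
          using norm_triangle_ineq4[of "N w" "poly (pderiv P) w"] c0(1)
          by (simp add: B_def distrib_right)
        have "norm (deriv f w / f w / w ^ (2 * n - 1)) = norm (N w - poly (pderiv P) w) / norm (poly P w) / y ^ (2 * n - 1)"
          using P_pos w by (simp add: N norm_divide norm_mult norm_power)
        also have "\<dots> \<le> c0 * B * y ^ (g + (2 * n - 2)) / (c0 * y ^ g) / y ^ (2 * n - 1)"
          using order_trans[OF norm_ge_zero num] num elim pos
          by (intro divide_right_mono frac_le) (auto simp: w_def)
        also have "\<dots> = B * inverse y"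
        proof -
          have "y ^ (2 * n - 1) = y ^ (2 * n - 2) * y"
            using n by (simp flip: power_Suc2 add: Suc_diff_Suc numeral_2_eq_2)
          then show ?thesis using c0(1) elim by (simp add: power_add field_simps)
        qed
        finally show ?case by (simp add: w_def)
      qed
    qed
    then have "\<exists>l r. V_form (n - 1) l r \<beta> c d f" by (rule V_form_drop[OF V n])
    then have "f \<in> V_class (n - 1)"
      unfolding V_class_iff_V_form \<beta>_def using \<alpha> by blast
    then show False using f(2) by simp
  qed
  have "2 * m \<le> g"
    unfolding g_def by (rule nonreal_zeros_le_degree[OF \<phi>P P f_holo f_nz assms(3)])
  then have "2 * m + 2 * n \<le> N\<^sub>0 + 2 * m\<^sub>1 + 2" using D e n by linarith
  then have "2 * real m - 2 * real m\<^sub>1 + 2 * real n - 2 \<le> real N\<^sub>0" by linarith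
  then show ?thesis using enat by simp
qed

end
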